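(* Let $\Phi_1\in \mathscr U$ and $\Phi_2\in \tilde{\mathscr U}$. Assume that $\frac{\Phi_2}{\Phi_1}$ is nondecreasing. Let $\alpha, \beta>-1$ and define for $t\in (0,\infty)$ $$\omega(t)=\frac{\Phi_2^{-1}\left(\frac{1}{t^{2+\beta}}\right)}{\Phi_1^{-1}\left(\frac{1}{t^{2+\alpha}}\right)}.$$ Then: (i) If $\Phi_1$ satisfies the $\nabla_2$-condition and $\omega$ is equivalent to $1$, then $\mathcal{M}\left(A_\alpha^{\Phi_1}(\mathbb{C}_+),A_\beta^{\Phi_2}(\mathbb{C}_+)\right)=H^\infty(\mathbb{C}_+)$. (ii) If $\omega$ is non-decreasing on $(0,\infty)$ and $\lim_{t\rightarrow 0}\omega(t)=0$, then $\mathcal{M}\left(A_\alpha^{\Phi_1}(\mathbb{C}_+),A_\beta^{\Phi_2}(\mathbb{C}_+)\right)=\{0\}$. (iii) If $\Phi_1$ and $\Phi_2\circ\Phi_1^{-1}$ satisfy the $\nabla_2$-condition and $\omega$ is non-increasing on $(0,\infty)$, then $\mathcal{M}\left(A_\alpha^{\Phi_1}(\mathbb{C}_+),A_\beta^{\Phi_2}(\mathbb{C}_+)\right)=\mathcal H_\omega^\infty(\mathbb{C}_+)$.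
   Context: $\mathbb{C}_+=\{x+iy: y>0\}$. A growth function is a continuous nondecreasing function from $[0,\infty)$ onto $[0,\infty)$; $\Phi^{-1}$ is its inverse. $\mathscr{U}^q$ ($q\ge1$) is the set of growth functions $\Phi$ with $\Phi(st)\le Ct^q\Phi(s)$ for $s>0,t\ge1$ and $t\mapsto\Phi(t)/t$ nondecreasing; $\mathscr{U}=\bigcup_{q\ge1}\mathscr{U}^q$. $\tilde{\mathscr U}$ is the set of $\Phi\in\mathscr U^q$ (some $q\ge1$) such that there are constants $C_1,C_2,C_3>0$ with: $\Phi(st)\le C_1\Phi(s)\Phi(t)$ for all $s,t>0$; $\Phi(a/b)\le C_2\Phi(a)/b^q$ for all $a,b\ge1$; $\Phi(a/b)\le C_3\Phi(a)/\Phi(b)$ for all $0<a\le b\le1$. A convex growth function $\Phi$ satisfies the $\nabla_2$-condition if both $\Phi$ and its complementary function $\Psi(s)=\sup_{t\ge0}\{ts-\Phi(t)\}$ satisfy $F(2t)\le KF(t)$ for some $K>1$, all $t\ge0$. For $\gamma>-1$, $dV_\gamma(x+iy)=y^\gamma dxdy$; $A^\Phi_\gamma(\mathbb{C}_+)$: holomorphic $f$ with $\int\Phi(|f|)dV_\gamma<\infty$, with $\|f\|^{lux}_{\Phi,\gamma}=\inf\{\lambda>0:\int\Phi(|f|/\lambda)dV_\gamma\le1\}$. $\mathcal M(X,Y)$ is the set of analytic $g$ on $\mathbb{C}_+$ with $\|fg\|_Y\le C\|f\|_X$ for all $f\in X$, some $C>0$. $H^\infty(\mathbb{C}_+)$: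 bounded analytic functions; $\mathcal H^\infty_\omega(\mathbb{C}_+)$: analytic $f$ with $\sup_{z\in\mathbb{C}_+}|f(z)|/\omega(\Im z)<\infty$. "$\omega$ equivalent to 1" means $c\le\omega\le C$ on $(0,\infty)$ for constants $0<c\le C$. *)

theory Defs
  imports "HOL-Analysis.Analysis"
begin

definition UHP :: "complex set" where
  "UHP = {z. Im z > 0}"

definition growth_fun :: "(real \<Rightarrow> real) \<Rightarrow> bool" where
  "growth_fun \<Phi> \<longleftrightarrow> continuous_on {0..} \<Phi> \<and> mono_on {0..} \<Phi> \<and> \<Phi> ` {0..} = {0..}"

text \<open>Inverse of a growth function (generalized inverse; the genuine inverse at positive
  arguments for the functions considered).\<close>
definition ginv :: "(real \<Rightarrow> real) \<Rightarrow> real \<Rightarrow> real" where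
  "ginv \<Phi> y = Inf {t. 0 \<le> t \<and> y \<le> \<Phi> t}"

definition U_q :: "real \<Rightarrow> (real \<Rightarrow> real) set" where
  "U_q q = {\<Phi>. growth_fun \<Phi> \<and>
      (\<exists>C>0. \<forall>s>0. \<forall>t\<ge>1. \<Phi> (s * t) \<le> C * t powr q * \<Phi> s) \<and>
      mono_on {0<..} (\<lambda>t. \<Phi> t / t)}"

definition U_class :: "(real \<Rightarrow> real) set" where
  "U_class = (\<Union>q\<in>{1..}. U_q q)"

definition U_tilde :: "(real \<Rightarrow> real) set" where
  "U_tilde = {\<Phi>. \<exists>q\<ge>1. \<Phi> \<in> U_q q \<and>
      (\<exists>C1>0. \<forall>s>0. \<forall>t>0. \<Phi> (s * t) \<le> C1 * \<Phi> s * \<Phi> t) \<and>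
      (\<exists>C2>0. \<forall>a\<ge>1. \<forall>b\<ge>1. \<Phi> (a / b) \<le> C2 * \<Phi> a / b powr q) \<and>
      (\<exists>C3>0. \<forall>a b. 0 < a \<and> a \<le> b \<and> b \<le> 1 \<longrightarrow> \<Phi> (a / b) \<le> C3 * \<Phi> a / \<Phi> b)}"

definition complementary :: "(real \<Rightarrow> real) \<Rightarrow> real \<Rightarrow> ereal" where
  "complementary \<Phi> s = (SUP t\<in>{0..}. ereal (t * s - \<Phi> t))"

definition Delta2_real :: "(real \<Rightarrow> real) \<Rightarrow> bool" where
  "Delta2_real F \<longleftrightarrow> (\<exists>K>1. \<forall>t\<ge>0. F (2 * t) \<le> K * F t)"

definition Delta2_ereal :: "(real \<Rightarrow> ereal) \<Rightarrow> bool" where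
  "Delta2_ereal F \<longleftrightarrow> (\<exists>K>1. \<forall>t\<ge>0. F (2 * t) \<le> ereal K * F t)"

definition nabla2 :: "(real \<Rightarrow> real) \<Rightarrow> bool" where
  "nabla2 \<Phi> \<longleftrightarrow> growth_fun \<Phi> \<and> convex_on {0..} \<Phi> \<and>
     Delta2_real \<Phi> \<and> Delta2_ereal (complementary \<Phi>)"

definition modular :: "(real \<Rightarrow> real) \<Rightarrow> real \<Rightarrow> (complex \<Rightarrow> complex) \<Rightarrow> ennreal" where
  "modular \<Phi> \<gamma> f = (\<integral>\<^sup>+ z. ennreal (\<Phi> (cmod (f z)) * Im z powr \<gamma>) * indicator UHP z \<partial>lborel)"

definition bergman_orlicz :: "(real \<Rightarrow> real) \<Rightarrow> real \<Rightarrow> (complex \<Rightarrow> complex) set" where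
  "bergman_orlicz \<Phi> \<gamma> = {f. f holomorphic_on UHP \<and> modular \<Phi> \<gamma> f < \<infinity>}"

definition lux_norm :: "(real \<Rightarrow> real) \<Rightarrow> real \<Rightarrow> (complex \<Rightarrow> complex) \<Rightarrow> real" where
  "lux_norm \<Phi> \<gamma> f = Inf {r. r > 0 \<and> modular \<Phi> \<gamma> (\<lambda>z. f z / of_real r) \<le> 1}"

definition multipliers ::
  "(real \<Rightarrow> real) \<Rightarrow> real \<Rightarrow> (real \<Rightarrow> real) \<Rightarrow> real \<Rightarrow> (complex \<Rightarrow> complex) set" where
  "multipliers \<Phi>1 \<alpha> \<Phi>2 \<beta> = {g. g analytic_on UHP \<and>
     (\<exists>C>0. \<forall>f\<in>bergman_orlicz \<Phi>1 \<alpha>.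
        (\<lambda>z. f z * g z) \<in> bergman_orlicz \<Phi>2 \<beta> \<and>
        lux_norm \<Phi>2 \<beta> (\<lambda>z. f z * g z) \<le> C * lux_norm \<Phi>1 \<alpha> f)}"

definition H_infty :: "(complex \<Rightarrow> complex) set" where
  "H_infty = {g. g analytic_on UHP \<and> (\<exists>C. \<forall>z\<in>UHP. cmod (g z) \<le> C)}"

definition H_infty_weighted :: "(real \<Rightarrow> real) \<Rightarrow> (complex \<Rightarrow> complex) set" where
  "H_infty_weighted \<omega> = {g. g analytic_on UHP \<and> (\<exists>C. \<forall>z\<in>UHP. cmod (g z) \<le> C * \<omega> (Im z))}"

end

theory Submission
  imports Defs "HOL-Complex_Analysis.Conformal_Mappings"
begin

text \<open>All three parts follow from the identity of the multiplier space with the weighted space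
  \<open>H_infty_weighted \<omega>\<close>. At height \<open>y\<close>, write \<open>T\<^sub>1\<close> and \<open>T\<^sub>2\<close> for the values of
  \<open>\<Phi>1\<^sup>-\<^sup>1\<close> at \<open>1 / y powr (2 + \<alpha>)\<close> and of \<open>\<Phi>2\<^sup>-\<^sup>1\<close> at \<open>1 / y powr (2 + \<beta>)\<close>,
  so that \<open>\<omega> = T\<^sub>2 / T\<^sub>1\<close>. The mean value inequality on a disc of radius \<open>y / 2\<close>
  bounds a function of norm 1 at height \<open>y\<close> by a multiple of \<open>T\<^sub>i\<close>; testing a multiplier
  against \<open>T\<^sub>1 (\<i> y\<^sub>0 / (w - cnj z\<^sub>0))\<^sup>k\<close> gives \<open>\<bar>g\<bar> \<le> C \<omega>\<close>. Conversely, if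
  \<open>\<bar>g\<bar> \<le> \<omega>\<close> and \<open>a = \<bar>f\<bar> \<le> T\<^sub>1\<close>, then submultiplicativity bounds \<open>\<Phi>2(a \<omega>)\<close> by a multiple of
  \<open>\<Phi>2(a / T\<^sub>1) \<Phi>2(T\<^sub>2)\<close>; the quotient conditions on \<open>\<Phi>2\<close> and the monotonicity of
  \<open>\<Phi>2 / \<Phi>1\<close> give \<open>\<Phi>2(a / T\<^sub>1) \<le> D \<Phi>1(a) / \<Phi>1(T\<^sub>1)\<close>, which is exactly the pointwise
  comparison of the two modulars. In part (ii) a multiplier tends to zero at the real line,
  hence vanishes.\<close>

subsection \<open>Lebesgue measure on the complex plane and mean values\<close>

lemma measurable_Complex [measurable]:
  assumes [measurable]: "f \<in> borel_measurable M" "g \<in> borel_measurable M"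
  shows "(\<lambda>x. Complex (f x) (g x)) \<in> borel_measurable M"
  unfolding Complex_eq by measurable

text \<open>Lebesgue measure is determined by its values on boxes, and a complex box is a product of
  two real intervals. This opens the way to Fubini in the real and imaginary parts.\<close>

lemma lborel_complex_eq_distr:
  "(lborel :: complex measure) = distr (lborel \<Otimes>\<^sub>M lborel) borel (\<lambda>(x, y). Complex x y)"
proof (rule lborel_eqI)
  fix l u :: complex
  assume le: "\<And>b. b \<in> Basis \<Longrightarrow> l \<bullet> b \<le> u \<bullet> b"
  have le': "Re l \<le> Re u" "Im l \<le> Im u"
    using le[of 1] le[of \<i>] by (auto simp: Basis_complex_def)
  have "(\<lambda>(x, y). Complex x y) -` box l u = {Re l<..<Re u} \<times> {Im l<..<Im u}"
    by (auto simp: in_box_complex_iff)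
  moreover have "(\<lambda>(x, y). Complex x y) \<in> borel_measurable (lborel \<Otimes>\<^sub>M lborel)"
    by measurable
  ultimately have "emeasure (distr (lborel \<Otimes>\<^sub>M lborel) borel (\<lambda>(x, y). Complex x y)) (box l u) =
      emeasure (lborel \<Otimes>\<^sub>M lborel) ({Re l<..<Re u} \<times> {Im l<..<Im u})"
    by (subst emeasure_distr) (auto simp: space_pair_measure)
  also have "\<dots> = ennreal (Re u - Re l) * ennreal (Im u - Im l)"
    using le' by (subst lborel.emeasure_pair_measure_Times) auto
  also have "\<dots> = (\<Prod>b\<in>Basis. (u - l) \<bullet> b)"
    using le' by (simp add: Basis_complex_def ennreal_mult complex_eq_iff)
  finally show "emeasure (distr (lborel \<Otimes>\<^sub>M lborel) borel (\<lambda>(x, y). Complex x y)) (box l u) =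
      (\<Prod>b\<in>Basis. (u - l) \<bullet> b)" .
qed simp

lemma nn_integral_complex:
  fixes f :: "complex \<Rightarrow> ennreal"
  assumes [measurable]: "f \<in> borel_measurable borel"
  shows "(\<integral>\<^sup>+z. f z \<partial>lborel) = (\<integral>\<^sup>+x. \<integral>\<^sup>+y. f (Complex x y) \<partial>lborel \<partial>lborel)"
    and "(\<integral>\<^sup>+z. f z \<partial>lborel) = (\<integral>\<^sup>+y. \<integral>\<^sup>+x. f (Complex x y) \<partial>lborel \<partial>lborel)"
proof -
  have "(\<integral>\<^sup>+z. f z \<partial>lborel) = (\<integral>\<^sup>+p. f (Complex (fst p) (snd p)) \<partial>(lborel \<Otimes>\<^sub>M lborel))"
    unfolding lborel_complex_eq_distr by (subst nn_integral_distr) (auto simp: case_prod_beta)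
  also have "\<dots> = (\<integral>\<^sup>+x. \<integral>\<^sup>+y. f (Complex x y) \<partial>lborel \<partial>lborel)"
    by (subst lborel.nn_integral_fst[symmetric]) auto
  finally show *: "(\<integral>\<^sup>+z. f z \<partial>lborel) = (\<integral>\<^sup>+x. \<integral>\<^sup>+y. f (Complex x y) \<partial>lborel \<partial>lborel)" .
  show "(\<integral>\<^sup>+z. f z \<partial>lborel) = (\<integral>\<^sup>+y. \<integral>\<^sup>+x. f (Complex x y) \<partial>lborel \<partial>lborel)"
    unfolding * by (rule lborel_pair.Fubini'[symmetric]) measurable
qed

lemma nn_integral_lborel_translate:
  fixes f :: "real \<Rightarrow> ennreal"
  assumes "f \<in> borel_measurable borel"
  shows "(\<integral>\<^sup>+x. f (x + a) \<partial>lborel) = (\<integral>\<^sup>+x. f x \<partial>lborel)"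
  using nn_integral_real_affine[OF assms, of 1 a] by (simp add: add.commute)

text \<open>With the unchanged coordinate fixed, a shear is a translation of the other one; the
  order of integration is chosen so that the moving coordinate is innermost.\<close>

lemma nn_integral_shear:
  fixes f :: "complex \<Rightarrow> ennreal"
  assumes [measurable]: "f \<in> borel_measurable borel"
  shows "(\<integral>\<^sup>+z. f (Complex (Re z + a * Im z) (Im z)) \<partial>lborel) = (\<integral>\<^sup>+z. f z \<partial>lborel)"
    and "(\<integral>\<^sup>+z. f (Complex (Re z) (Im z + a * Re z)) \<partial>lborel) = (\<integral>\<^sup>+z. f z \<partial>lborel)"
proof -
  have "(\<integral>\<^sup>+z. f (Complex (Re z + a * Im z) (Im z)) \<partial>lborel) =
      (\<integral>\<^sup>+y. \<integral>\<^sup>+x. f (Complex (x + a * y) y) \<partial>lborel \<partial>lborel)"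
    by (subst nn_integral_complex(2)) auto
  also have "\<dots> = (\<integral>\<^sup>+y. \<integral>\<^sup>+x. f (Complex x y) \<partial>lborel \<partial>lborel)"
    by (intro nn_integral_cong nn_integral_lborel_translate) measurable
  finally show "(\<integral>\<^sup>+z. f (Complex (Re z + a * Im z) (Im z)) \<partial>lborel) = (\<integral>\<^sup>+z. f z \<partial>lborel)"
    by (simp add: nn_integral_complex(2))
  have "(\<integral>\<^sup>+z. f (Complex (Re z) (Im z + a * Re z)) \<partial>lborel) =
      (\<integral>\<^sup>+x. \<integral>\<^sup>+y. f (Complex x (y + a * x)) \<partial>lborel \<partial>lborel)"
    by (subst nn_integral_complex(1)) auto
  also have "\<dots> = (\<integral>\<^sup>+x. \<integral>\<^sup>+y. f (Complex x y) \<partial>lborel \<partial>lborel)"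
    by (intro nn_integral_cong nn_integral_lborel_translate) measurable
  finally show "(\<integral>\<^sup>+z. f (Complex (Re z) (Im z + a * Re z)) \<partial>lborel) = (\<integral>\<^sup>+z. f z \<partial>lborel)"
    by (simp add: nn_integral_complex(1))
qed

text \<open>A rotation other than \<open>-1\<close> is a product of three shears, the outer ones with parameter
  minus the tangent of half the angle.\<close>

lemma nn_integral_rotate_aux:
  fixes f :: "complex \<Rightarrow> ennreal"
  assumes [measurable]: "f \<in> borel_measurable borel" and c: "cmod c = 1" "c \<noteq> -1"
  shows "(\<integral>\<^sup>+z. f (c * z) \<partial>lborel) = (\<integral>\<^sup>+z. f z \<partial>lborel)"
proof -
  define p where "p = Re c"
  define s where "s = Im c"
  have ps: "p\<^sup>2 + s\<^sup>2 = 1"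
    using c(1) by (metis cmod_power2 one_power2 p_def s_def)
  have p: "1 + p \<noteq> 0"
  proof
    assume "1 + p = 0"
    then have "p = -1" by simp
    then have "s = 0" using ps by simp
    with \<open>p = -1\<close> c(2) show False by (simp add: complex_eq_iff p_def s_def)
  qed
  define a where "a = - s / (1 + p)"
  \<comment> \<open>These are entries of the matrix of the three shears composed: both diagonal
    entries are \<open>1 + a * s\<close>, to be the cosine \<open>p\<close>, and the upper right one
    is to be minus the sine \<open>s\<close>.\<close>
  have a: "1 + a * s = p" "a + (1 + a * s) * a = - s"
  proof -
    show 1: "1 + a * s = p"
      using p ps by (simp add: a_def field_simps power2_eq_square)
    have "a * (1 + p) = - s"
      using p by (simp add: a_def)
    then have "a + p * a = - s"
      by (simp add: algebra_simps)
    then show "a + (1 + a * s) * a = - s" by (simp add: 1)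
  qed
  define S where "S = (\<lambda>z. Complex (Re z + a * Im z) (Im z))"
  define T where "T = (\<lambda>z. Complex (Re z) (Im z + s * Re z))"
  have [measurable]: "S \<in> borel_measurable borel" "T \<in> borel_measurable borel"
    unfolding S_def T_def by measurable
  have eq: "c * z = S (T (S z))" for z
  proof -
    have "Re (S (T (S z))) = (1 + a * s) * Re z + (a + (1 + a * s) * a) * Im z"
      "Im (S (T (S z))) = s * Re z + (1 + a * s) * Im z"
      by (simp_all add: S_def T_def algebra_simps)
    then show ?thesis
      unfolding a(2) unfolding a(1) by (simp add: complex_eq_iff p_def s_def)
  qed
  have "(\<integral>\<^sup>+z. f (S (T (S z))) \<partial>lborel) = (\<integral>\<^sup>+z. f (S (T z)) \<partial>lborel)"
    using nn_integral_shear(1)[of "\<lambda>z. f (S (T z))" a] by (simp add: S_def)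
  also have "\<dots> = (\<integral>\<^sup>+z. f (S z) \<partial>lborel)"
    using nn_integral_shear(2)[of "\<lambda>z. f (S z)" s] by (simp add: T_def)
  also have "\<dots> = (\<integral>\<^sup>+z. f z \<partial>lborel)"
    using nn_integral_shear(1)[of "f" a] by (simp add: S_def)
  finally show ?thesis by (simp add: eq)
qed

text \<open>The half turn, where the shear parameter has a zero denominator, is performed as two
  quarter turns.\<close>

lemma nn_integral_rotate:
  fixes f :: "complex \<Rightarrow> ennreal"
  assumes [measurable]: "f \<in> borel_measurable borel" and c: "cmod c = 1"
  shows "(\<integral>\<^sup>+z. f (c * z) \<partial>lborel) = (\<integral>\<^sup>+z. f z \<partial>lborel)"
proof (cases "c = -1")
  case True
  have "(\<integral>\<^sup>+z. f (\<i> * (\<i> * z)) \<partial>lborel) = (\<integral>\<^sup>+z. f (\<i> * z) \<partial>lborel)"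
    by (rule nn_integral_rotate_aux) (auto simp: complex_eq_iff)
  also have "\<dots> = (\<integral>\<^sup>+z. f z \<partial>lborel)"
    by (rule nn_integral_rotate_aux) (auto simp: complex_eq_iff)
  finally show ?thesis
    unfolding True by (simp flip: mult.assoc)
qed (use assms nn_integral_rotate_aux in auto)

text \<open>Cauchy's formula at the centre: along the circle the factor \<open>1 / u\<close> cancels
  against the derivative of the parametrisation up to the constant
  \<open>2 * pi * \<i>\<close>.\<close>

lemma has_integral_circle_mean:
  assumes "f holomorphic_on cball 0 1"
  shows "((\<lambda>t. f (exp (2 * of_real pi * \<i> * of_real t))) has_integral f 0) {0..1}"
proof -
  have "((\<lambda>u. f u / (u - 0)) has_contour_integral (2 * of_real pi * \<i> * f 0)) (circlepath 0 1)"
    by (rule Cauchy_integral_circlepath_simple[OF assms]) simp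
  then have "((\<lambda>t. f (exp (2 * of_real pi * \<i> * of_real t)) * (2 * of_real pi * \<i>))
      has_integral (2 * of_real pi * \<i> * f 0)) {0..1}"
    unfolding has_contour_integral vector_derivative_circlepath
    by (simp add: circlepath field_simps)
  then have "((\<lambda>t. f (exp (2 * of_real pi * \<i> * of_real t)) * (2 * of_real pi * \<i>) / (2 * of_real pi * \<i>))
      has_integral (2 * of_real pi * \<i> * f 0) / (2 * of_real pi * \<i>)) {0..1}"
    by (rule has_integral_divide)
  then show ?thesis by simp
qed

lemma circle_mean_inequality:
  assumes "f holomorphic_on cball 0 1"
  shows "ennreal (cmod (f 0)) \<le>
    (\<integral>\<^sup>+t. ennreal (cmod (f (exp (2 * of_real pi * \<i> * of_real t)))) * indicator {0..1} t \<partial>lborel)"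
proof -
  define F where "F = (\<lambda>t::real. f (exp (2 * of_real pi * \<i> * of_real t)))"
  have cont: "continuous_on {0..1} F"
    unfolding F_def
    by (rule continuous_on_compose2[OF holomorphic_on_imp_continuous_on[OF assms]])
      (auto intro!: continuous_intros simp: norm_exp_eq_Re)
  then have cn: "continuous_on {0..1} (\<lambda>t. cmod (F t))"
    by (intro continuous_intros)
  have "cmod (f 0) = cmod (integral {0..1} F)"
    using has_integral_circle_mean[OF assms] by (simp add: F_def integral_unique)
  also have "\<dots> \<le> integral {0..1} (\<lambda>t. cmod (F t))"
    by (intro integral_norm_bound_integral integrable_continuous_interval cont cn) auto
  finally have "ennreal (cmod (f 0)) \<le> ennreal (integral {0..1} (\<lambda>t. cmod (F t)))"
    by (rule ennreal_leI)
  also have "\<dots> = (\<integral>\<^sup>+t. ennreal (cmod (F t)) * indicator {0..1} t \<partial>lborel)"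
  proof -
    have "(\<integral>\<^sup>+t. ennreal (indicator {0..1} t * cmod (F t)) \<partial>lborel) = integral {0..1} (\<lambda>t. cmod (F t))"
    proof (rule nn_integral_has_integral_lborel)
      show "(\<lambda>t. indicator {0..1} t * cmod (F t)) \<in> borel_measurable borel"
        using borel_measurable_continuous_on_indicator[OF _ cn] by simp
      have "((\<lambda>t. if t \<in> {0..1} then cmod (F t) else 0) has_integral integral {0..1} (\<lambda>t. cmod (F t))) UNIV"
        unfolding has_integral_restrict_UNIV
        by (intro integrable_integral integrable_continuous_interval cn)
      then show "((\<lambda>t. indicator {0..1} t * cmod (F t)) has_integral integral {0..1} (\<lambda>t. cmod (F t))) UNIV"
        by (rule has_integral_eq[rotated]) (auto simp: indicator_def)
    qed auto
    then show ?thesis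
      by (auto simp: ennreal_mult' mult.commute ennreal_indicator)
  qed
  finally show ?thesis by (simp add: F_def)
qed

text \<open>Averaging the integral over the disc over all rotations reduces this to circle means,
  without polar coordinates.\<close>

lemma disc_mean_inequality:
  assumes hol: "h holomorphic_on ball z R"
  shows "ennreal (cmod (h z)) * emeasure lborel (ball z R) \<le>
    (\<integral>\<^sup>+w. ennreal (cmod (h w)) * indicator (ball z R) w \<partial>lborel)"
proof -
  define G where "G = (\<lambda>w. ennreal (cmod (h w)) * indicator (ball z R) w)"
  define F where "F = (\<lambda>u. G (z + u))"
  define e where "e = (\<lambda>t::real. exp (2 * of_real pi * \<i> * of_real t))"
  have e: "cmod (e t) = 1" for t by (simp add: e_def norm_exp_eq_Re)
  have cont: "continuous_on (ball z R) (\<lambda>w. cmod (h w))"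
    by (intro continuous_intros holomorphic_on_imp_continuous_on hol)
  have "(\<lambda>w. ennreal (indicator (ball z R) w *\<^sub>R cmod (h w))) \<in> borel_measurable borel"
    by (intro measurable_compose[OF _ measurable_ennreal]
        borel_measurable_continuous_on_indicator cont) auto
  moreover have "(\<lambda>w. ennreal (indicator (ball z R) w *\<^sub>R cmod (h w))) = G"
    by (auto simp: G_def fun_eq_iff indicator_def)
  ultimately have [measurable]: "G \<in> borel_measurable borel" by argo
  have [measurable]: "F \<in> borel_measurable borel"
    unfolding F_def by measurable
  have "continuous_on UNIV e"
    unfolding e_def by (intro continuous_intros)
  then have [measurable]: "e \<in> borel_measurable borel"
    by (rule borel_measurable_continuous_onI)
  have trans: "(\<integral>\<^sup>+u. g (z + u) \<partial>lborel) = (\<integral>\<^sup>+w. g w \<partial>lborel)"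
    if [measurable]: "g \<in> borel_measurable borel" for g :: "complex \<Rightarrow> ennreal"
    by (subst (2) lborel_distr_plus[of z, symmetric]) (simp add: nn_integral_distr)
  have "ennreal (cmod (h z)) * emeasure lborel (ball z R) =
      (\<integral>\<^sup>+w. ennreal (cmod (h z)) * indicator (ball z R) w \<partial>lborel)"
    by (simp add: nn_integral_cmult_indicator)
  also have "\<dots> = (\<integral>\<^sup>+u. ennreal (cmod (h z)) * indicator (ball z R) (z + u) \<partial>lborel)"
    by (intro trans[symmetric] borel_measurable_times_ennreal borel_measurable_const
        borel_measurable_indicator) simp
  \<comment> \<open>For each \<open>u\<close> in the centred disc, the circle mean inequality is
    applied to \<open>w \<mapsto> h (z + w * u)\<close>, whose value at 0 is \<open>h z\<close>. For
    the other \<open>u\<close> the left side is 0.\<close>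
  also have "\<dots> \<le> (\<integral>\<^sup>+u. \<integral>\<^sup>+t. F (e t * u) * indicator {0..1} t \<partial>lborel \<partial>lborel)"
  proof (rule nn_integral_mono)
    fix u :: complex
    show "ennreal (cmod (h z)) * indicator (ball z R) (z + u) \<le>
        (\<integral>\<^sup>+t. F (e t * u) * indicator {0..1} t \<partial>lborel)"
    proof (cases "cmod u < R")
      case True
      have in_ball: "z + w * u \<in> ball z R" if "cmod w \<le> 1" for w
      proof -
        have "cmod w * cmod u \<le> 1 * cmod u"
          using that by (intro mult_right_mono) auto
        with True show ?thesis by (simp add: dist_norm norm_mult)
      qed
      have "(\<lambda>w. h (z + w * u)) holomorphic_on cball 0 1"
        by (rule holomorphic_on_compose_gen[OF _ hol, unfolded o_def])
          (auto intro!: holomorphic_intros in_ball)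
      from circle_mean_inequality[OF this]
      have "ennreal (cmod (h z)) \<le>
          (\<integral>\<^sup>+t. ennreal (cmod (h (z + e t * u))) * indicator {0..1} t \<partial>lborel)"
        by (simp add: e_def)
      also have "\<dots> = (\<integral>\<^sup>+t. F (e t * u) * indicator {0..1} t \<partial>lborel)"
        using in_ball e by (intro nn_integral_cong) (auto simp: F_def G_def indicator_def)
      finally show ?thesis
        using True by (simp add: dist_norm)
    qed (simp add: dist_norm)
  qed
  \<comment> \<open>After the swap the inner integral is independent of the rotation
    \<open>e t\<close>, so averaging over an interval of length 1 returns the plain integral of
    \<open>F\<close>.\<close>
  also have "\<dots> = (\<integral>\<^sup>+t. \<integral>\<^sup>+u. F (e t * u) * indicator {0..1} t \<partial>lborel \<partial>lborel)"
    by (rule lborel_pair.Fubini'[symmetric]) measurable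
  also have "\<dots> = (\<integral>\<^sup>+t. (\<integral>\<^sup>+u. F u \<partial>lborel) * indicator {0..1} (t::real) \<partial>lborel)"
    by (intro nn_integral_cong)
      (simp add: nn_integral_multc nn_integral_rotate[OF _ e])
  also have "\<dots> = (\<integral>\<^sup>+u. F u \<partial>lborel)"
    by (simp add: nn_integral_cmult_indicator)
  also have "\<dots> = (\<integral>\<^sup>+w. G w \<partial>lborel)"
    unfolding F_def by (rule trans) measurable
  finally show ?thesis by (simp add: G_def)
qed

subsection \<open>Growth functions, modulars and the pointwise bound\<close>

locale growth =
  fixes \<Phi> :: "real \<Rightarrow> real" and q :: real
  assumes U_q: "\<Phi> \<in> U_q q"
begin

lemma continuous: "continuous_on {0..} \<Phi>"
  using U_q by (auto simp: U_q_def growth_fun_def)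

lemma mono: "0 \<le> s \<Longrightarrow> s \<le> t \<Longrightarrow> \<Phi> s \<le> \<Phi> t"
  using U_q by (auto simp: U_q_def growth_fun_def mono_on_def)

lemma surj: "y \<ge> 0 \<Longrightarrow> \<exists>t\<ge>0. \<Phi> t = y"
proof -
  assume "y \<ge> 0"
  then have "y \<in> \<Phi> ` {0..}"
    using U_q by (simp add: U_q_def growth_fun_def)
  then show ?thesis by auto
qed

lemma nonneg: "t \<ge> 0 \<Longrightarrow> \<Phi> t \<ge> 0"
proof -
  assume "t \<ge> 0"
  then have "\<Phi> t \<in> \<Phi> ` {0..}" by simp
  then show ?thesis
    using U_q by (simp add: U_q_def growth_fun_def)
qed

lemma zero: "\<Phi> 0 = 0"
proof -
  obtain t where "t \<ge> 0" "\<Phi> t = 0" using surj[of 0] by auto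
  then show ?thesis using mono[of 0 t] nonneg[of 0] by simp
qed

lemma upper_type: "\<exists>C>0. \<forall>s\<ge>0. \<forall>t\<ge>1. \<Phi> (s * t) \<le> C * t powr q * \<Phi> s"
proof -
  obtain C where C: "C > 0" "\<And>s t. s > 0 \<Longrightarrow> t \<ge> 1 \<Longrightarrow> \<Phi> (s * t) \<le> C * t powr q * \<Phi> s"
    using U_q by (auto simp: U_q_def)
  have "\<Phi> (s * t) \<le> C * t powr q * \<Phi> s" if "s \<ge> 0" "t \<ge> 1" for s t
    using that C(2)[of s t] by (cases "s = 0") (auto simp: zero)
  with C(1) show ?thesis by blast
qed

text \<open>A zero at some \<open>t > 0\<close> would spread to all larger arguments by the upper
  type inequality, contradicting surjectivity.\<close>

lemma pos: "t > 0 \<Longrightarrow> \<Phi> t > 0"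
proof (rule ccontr)
  assume t: "t > 0" and "\<not> \<Phi> t > 0"
  then have 0: "\<Phi> t = 0" using nonneg[of t] by simp
  obtain C where C: "\<And>s r. s \<ge> 0 \<Longrightarrow> r \<ge> 1 \<Longrightarrow> \<Phi> (s * r) \<le> C * r powr q * \<Phi> s"
    using upper_type by auto
  obtain u where u: "u \<ge> 0" "\<Phi> u = 1" using surj[of 1] by auto
  define v where "v = max t u"
  have "1 \<le> \<Phi> v" using mono[of u v] u by (simp add: v_def)
  also have "\<Phi> v \<le> 0" using C[of t "v / t"] t 0 by (simp add: v_def)
  finally show False by simp
qed

lemma ratio_mono: "0 < s \<Longrightarrow> s \<le> t \<Longrightarrow> \<Phi> s / s \<le> \<Phi> t / t"
  using U_q by (auto simp: U_q_def mono_on_def)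

text \<open>The monotone quotient \<open>\<Phi> t / t\<close>, compared at \<open>s * t\<close> and
  \<open>t\<close>. It replaces convexity throughout: a factor at most 1 may be pulled out of
  \<open>\<Phi>\<close>.\<close>

lemma contract: "0 \<le> s \<Longrightarrow> s \<le> 1 \<Longrightarrow> 0 \<le> t \<Longrightarrow> \<Phi> (s * t) \<le> s * \<Phi> t"
proof -
  assume s: "0 \<le> s" "s \<le> 1" and t: "0 \<le> t"
  show ?thesis
  proof (cases "s = 0 \<or> t = 0")
    case False
    then have "0 < s" "0 < t" using s t by auto
    moreover from this have "\<Phi> (s * t) / (s * t) \<le> \<Phi> t / t"
      using s by (intro ratio_mono) (auto simp: mult_le_cancel_right1)
    ultimately show ?thesis by (simp add: field_simps)
  qed (auto simp: zero)
qed

lemma divide_le: "r \<ge> 1 \<Longrightarrow> t \<ge> 0 \<Longrightarrow> \<Phi> (t / r) \<le> \<Phi> t / r"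
  using contract[of "1 / r" t] by simp

text \<open>From \<open>contract\<close> with the factor \<open>s / t < 1\<close> and positivity. It
  makes \<open>ginv\<close> the genuine inverse, since the set under the infimum becomes a
  half-line.\<close>

lemma strict_mono: "0 \<le> s \<Longrightarrow> s < t \<Longrightarrow> \<Phi> s < \<Phi> t"
proof -
  assume "0 \<le> s" "s < t"
  then have "\<Phi> s \<le> s / t * \<Phi> t"
    using contract[of "s / t" t] by simp
  also have "\<dots> < 1 * \<Phi> t"
    using \<open>0 \<le> s\<close> \<open>s < t\<close> by (intro mult_strict_right_mono pos) auto
  finally show ?thesis by simp
qed

lemma ginv_eq: "t \<ge> 0 \<Longrightarrow> ginv \<Phi> (\<Phi> t) = t"
proof -
  assume t: "t \<ge> 0"
  have "{s. 0 \<le> s \<and> \<Phi> t \<le> \<Phi> s} = {t..}"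
  proof (intro set_eqI iffI)
    fix s assume "s \<in> {s. 0 \<le> s \<and> \<Phi> t \<le> \<Phi> s}"
    then show "s \<in> {t..}" using strict_mono[of s t] by force
  qed (use t mono in auto)
  then show ?thesis by (simp add: ginv_def)
qed

lemma
  assumes "y > 0"
  shows ginv_pos: "ginv \<Phi> y > 0" and ginv_right: "\<Phi> (ginv \<Phi> y) = y"
proof -
  obtain t where t: "t \<ge> 0" "\<Phi> t = y" using surj[of y] assms by auto
  then have "t \<noteq> 0" using zero assms by auto
  with t ginv_eq[of t] show "ginv \<Phi> y > 0" "\<Phi> (ginv \<Phi> y) = y" by auto
qed

lemma le_ginv: "0 < y \<Longrightarrow> \<Phi> a \<le> y \<Longrightarrow> a \<le> ginv \<Phi> y"
  using strict_mono[of "ginv \<Phi> y" a] ginv_pos[of y] ginv_right[of y] by force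

lemma modular_integrand_measurable:
  assumes "continuous_on UHP f"
  shows "(\<lambda>z. ennreal (\<Phi> (cmod (f z)) * Im z powr \<gamma>) * indicator UHP z) \<in> borel_measurable borel"
proof -
  have [measurable]: "UHP \<in> sets borel"
    unfolding UHP_def by (intro borel_open open_halfspace_Im_gt)
  have "continuous_on UHP (\<lambda>z. \<Phi> (cmod (f z)) * Im z powr \<gamma>)"
    by (rule continuous_on_mult, rule continuous_on_compose2[OF continuous])
      (use assms in \<open>auto intro!: continuous_intros simp: UHP_def\<close>)
  then have "(\<lambda>z. ennreal (indicator UHP z *\<^sub>R (\<Phi> (cmod (f z)) * Im z powr \<gamma>))) \<in> borel_measurable borel"
    by (intro measurable_compose[OF _ measurable_ennreal]
        borel_measurable_continuous_on_indicator) auto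
  moreover have "(\<lambda>z. ennreal (indicator UHP z *\<^sub>R (\<Phi> (cmod (f z)) * Im z powr \<gamma>))) =
      (\<lambda>z. ennreal (\<Phi> (cmod (f z)) * Im z powr \<gamma>) * indicator UHP z)"
    by (auto simp: fun_eq_iff indicator_def)
  ultimately show ?thesis by argo
qed

text \<open>Jensen's inequality with a factor 2, as \<open>\<Phi>\<close> need not be convex.\<close>

lemma tangent_bound:
  assumes m: "m > 0" and t: "t \<ge> 0"
  shows "\<Phi> m / m * t \<le> \<Phi> t + \<Phi> m"
proof (cases "t \<le> m")
  case True
  then have "\<Phi> m / m * t \<le> \<Phi> m / m * m"
    using m pos[OF m] by (intro mult_left_mono) auto
  then show ?thesis using m nonneg[OF t] by simp
next
  case False
  then have "\<Phi> m / m * t \<le> \<Phi> t / t * t"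
    using m by (intro mult_right_mono ratio_mono) auto
  then show ?thesis using False m pos[OF m] by simp
qed

end

section \<open>Comparison of modulars and the Luxemburg norm\<close>

lemma open_UHP: "open UHP"
  unfolding UHP_def by (rule open_halfspace_Im_gt)

text \<open>The weights stay inside the pointwise hypothesis because the two modulars may carry
  different exponents.\<close>

lemma modular_le_scaled:
  assumes "growth \<Psi> q" "continuous_on UHP g" "K \<ge> 0"
    and le: "\<And>z. z \<in> UHP \<Longrightarrow> \<Phi> (cmod (f z)) * Im z powr \<beta> \<le> K * (\<Psi> (cmod (g z)) * Im z powr \<alpha>)"
  shows "modular \<Phi> \<beta> f \<le> ennreal K * modular \<Psi> \<alpha> g"
proof -
  interpret growth \<Psi> q by fact
  have "modular \<Phi> \<beta> f \<le>
      (\<integral>\<^sup>+z. ennreal K * (ennreal (\<Psi> (cmod (g z)) * Im z powr \<alpha>) * indicator UHP z) \<partial>lborel)"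
    unfolding modular_def
    using le assms(3) by (intro nn_integral_mono)
      (auto simp: indicator_def nonneg ennreal_leI simp flip: ennreal_mult)
  also have "\<dots> = ennreal K * modular \<Psi> \<alpha> g"
    unfolding modular_def
    using modular_integrand_measurable[OF assms(2)] by (intro nn_integral_cmult) simp
  finally show ?thesis .
qed

lemma (in growth) modular_divide:
  assumes "continuous_on UHP f" "r \<ge> 1"
  shows "modular \<Phi> \<gamma> (\<lambda>z. f z / of_real r) \<le> ennreal (1 / r) * modular \<Phi> \<gamma> f"
proof (rule modular_le_scaled[OF growth_axioms])
  fix z
  have "\<Phi> (cmod (f z) / r) * Im z powr \<gamma> \<le> \<Phi> (cmod (f z)) / r * Im z powr \<gamma>"
    using assms by (intro mult_right_mono divide_le) auto
  then show "\<Phi> (cmod (f z / of_real r)) * Im z powr \<gamma> \<le> 1 / r * (\<Phi> (cmod (f z)) * Im z powr \<gamma>)"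
    using assms(2) by (simp add: norm_divide)
qed (use assms in auto)

lemma (in growth) modular_divide_le_1:
  assumes "continuous_on UHP f" "r \<ge> 1" "modular \<Phi> \<gamma> f \<le> ennreal r"
  shows "modular \<Phi> \<gamma> (\<lambda>z. f z / of_real r) \<le> 1"
proof -
  have "modular \<Phi> \<gamma> (\<lambda>z. f z / of_real r) \<le> ennreal (1 / r) * ennreal r"
    using modular_divide[OF assms(1,2), of \<gamma>] mult_left_mono[OF assms(3), of "ennreal (1 / r)"]
    by simp
  also have "\<dots> = 1"
    using assms(2) by (simp flip: ennreal_mult)
  finally show ?thesis .
qed

text \<open>Guarantees that the infimum defining \<open>lux_norm\<close> is taken over a nonempty
  set; without this its value would carry no information.\<close>

lemma (in growth) modular_divide_le_1_ex:
  assumes "continuous_on UHP f" "modular \<Phi> \<gamma> f < \<infinity>"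
  shows "\<exists>r>0. modular \<Phi> \<gamma> (\<lambda>z. f z / of_real r) \<le> 1"
proof -
  define r where "r = max 1 (enn2real (modular \<Phi> \<gamma> f))"
  have "modular \<Phi> \<gamma> f = ennreal (enn2real (modular \<Phi> \<gamma> f))"
    using assms(2) by simp
  also have "\<dots> \<le> ennreal r" by (intro ennreal_leI) (simp add: r_def)
  finally have "modular \<Phi> \<gamma> (\<lambda>z. f z / of_real r) \<le> 1"
    using assms(1) by (intro modular_divide_le_1) (auto simp: r_def)
  moreover have "r > 0" by (simp add: r_def)
  ultimately show ?thesis by blast
qed

lemma lux_norm_le: "r > 0 \<Longrightarrow> modular \<Phi> \<gamma> (\<lambda>z. f z / of_real r) \<le> 1 \<Longrightarrow> lux_norm \<Phi> \<gamma> f \<le> r"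
  unfolding lux_norm_def by (rule cInf_lower) (auto intro!: bdd_belowI[of _ 0])

text \<open>Heights in the disc of radius \<open>y / 2\<close> about a point of height
  \<open>y\<close> range over this interval. The sign of \<open>\<gamma>\<close> decides which end
  gives the smaller power, hence the \<open>min\<close>.\<close>

lemma powr_ge_within_half:
  fixes y s \<gamma> :: real
  assumes "y > 0" "y / 2 \<le> s" "s \<le> 3 / 2 * y"
  shows "min ((1/2) powr \<gamma>) ((3/2) powr \<gamma>) * y powr \<gamma> \<le> s powr \<gamma>"
proof (cases "\<gamma> \<ge> 0")
  case True
  have "min ((1/2) powr \<gamma>) ((3/2) powr \<gamma>) * y powr \<gamma> \<le> (1/2) powr \<gamma> * y powr \<gamma>"
    by (intro mult_right_mono) auto
  also have "\<dots> = (y / 2) powr \<gamma>"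
    using assms by (simp add: powr_divide)
  also have "\<dots> \<le> s powr \<gamma>"
    using True assms by (intro powr_mono2) auto
  finally show ?thesis .
next
  case False
  have "min ((1/2) powr \<gamma>) ((3/2) powr \<gamma>) * y powr \<gamma> \<le> (3/2) powr \<gamma> * y powr \<gamma>"
    by (intro mult_right_mono) auto
  also have "\<dots> = (3 / 2 * y) powr \<gamma>"
    using assms by (subst powr_mult) auto
  also have "\<dots> \<le> s powr \<gamma>"
    using False assms by (intro powr_mono2') auto
  finally show ?thesis .
qed

text \<open>On the disc of radius \<open>y / 2\<close> the weight is comparable to
  \<open>y powr \<gamma>\<close>, so a modular of at most 1 bounds the integral of
  \<open>\<Phi> (cmod (h w))\<close> there. The mean value inequality and
  \<open>tangent_bound\<close> turn this into a bound on \<open>\<Phi> (m / 2)\<close> with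
  \<open>m = cmod (h z)\<close>, which is then inverted.\<close>

lemma (in growth) pointwise_bound:
  "\<exists>C>0. \<forall>h z. h holomorphic_on UHP \<longrightarrow> modular \<Phi> \<gamma> h \<le> 1 \<longrightarrow> z \<in> UHP \<longrightarrow>
     cmod (h z) \<le> C * ginv \<Phi> (1 / Im z powr (2 + \<gamma>))"
proof -
  define c :: real where "c = min ((1/2) powr \<gamma>) ((3/2) powr \<gamma>)"
  have c: "c > 0" by (auto simp: c_def)
  \<comment> \<open>The disc has area \<open>pi * y\<^sup>2 / 4\<close>, which accounts for the
    fraction. The maximum with 1 allows \<open>divide_le\<close> to move \<open>D\<close> into the
    argument of \<open>\<Phi>\<close>.\<close>
  define D where "D = max 1 (4 / (pi * c))"
  have D: "D \<ge> 1" by (simp add: D_def)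
  have "cmod (h z) \<le> 2 * D * ginv \<Phi> (1 / Im z powr (2 + \<gamma>))"
    if hol: "h holomorphic_on UHP" and mod: "modular \<Phi> \<gamma> h \<le> 1" and z: "z \<in> UHP" for h z
  proof -
    define y where "y = Im z"
    have y: "y > 0" using z by (simp add: y_def UHP_def)
    define Y where "Y = ginv \<Phi> (1 / y powr (2 + \<gamma>))"
    have Y: "Y > 0" unfolding Y_def using y by (intro ginv_pos) auto
    define m where "m = cmod (h z)"
    show ?thesis
    proof (cases "m = 0")
      case True
      then show ?thesis using Y D by (simp add: m_def Y_def y_def)
    next
      case False
      then have m: "m > 0" by (simp add: m_def)
      define B where "B = ball z (y / 2)"
      define P where "P = \<Phi> (m / 2)"
      have P: "P > 0" using pos m by (simp add: P_def)
      define b where "b = pi * (y / 2)\<^sup>2"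
      have b: "b > 0" using y by (simp add: b_def)
      have emB: "emeasure lborel B = ennreal b"
        using y by (simp add: B_def emeasure_ball unit_ball_vol_2 b_def)
      have [measurable]: "B \<in> sets borel" by (simp add: B_def)
      have Im: "y / 2 \<le> Im w" "Im w \<le> 3 / 2 * y" if "w \<in> B" for w
      proof -
        have "\<bar>Im (z - w)\<bar> < y / 2"
          using that abs_Im_le_cmod[of "z - w"] by (simp add: B_def dist_norm)
        then show "y / 2 \<le> Im w" "Im w \<le> 3 / 2 * y"
          by (auto simp: y_def abs_if split: if_splits)
      qed
      then have B: "B \<subseteq> UHP" using y by (force simp: UHP_def)
      have cont: "continuous_on UHP h" using hol by (rule holomorphic_on_imp_continuous_on)
      have cB: "continuous_on B h" using cont B by (rule continuous_on_subset)
      have cPB: "continuous_on B (\<lambda>w. \<Phi> (cmod (h w)))"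
        by (rule continuous_on_compose2[OF continuous]) (auto intro!: continuous_intros cB)
      have meas: "(\<lambda>w. ennreal (k w) * indicator B w) \<in> borel_measurable borel"
        if "continuous_on B k" for k
      proof -
        have "(\<lambda>w. ennreal (indicator B w *\<^sub>R k w)) \<in> borel_measurable borel"
          using that by (intro measurable_compose[OF _ measurable_ennreal]
              borel_measurable_continuous_on_indicator) auto
        moreover have "(\<lambda>w. ennreal (indicator B w *\<^sub>R k w)) = (\<lambda>w. ennreal (k w) * indicator B w)"
          by (auto simp: fun_eq_iff indicator_def)
        ultimately show ?thesis by argo
      qed
      note [measurable] = meas[OF cPB] meas[OF continuous_on_norm[OF cB]]
      define X where "X = (\<integral>\<^sup>+w. ennreal (\<Phi> (cmod (h w))) * indicator B w \<partial>lborel)"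
      \<comment> \<open>The tangent is taken at \<open>m / 2\<close>, not at \<open>m\<close>: its
        slope times \<open>m\<close> is then \<open>2 * P\<close>, while the error term of
        \<open>tangent_bound\<close> costs only \<open>P\<close>. Half of the left side thus
        survives when \<open>P * b\<close> is subtracted.\<close>
      have "ennreal (2 * P * b) = ennreal (P / (m / 2)) * (ennreal m * ennreal b)"
        using m P b by (simp flip: ennreal_mult)
      also have "\<dots> \<le> ennreal (P / (m / 2)) * (\<integral>\<^sup>+w. ennreal (cmod (h w)) * indicator B w \<partial>lborel)"
        using disc_mean_inequality[OF holomorphic_on_subset[OF hol B[unfolded B_def]]]
        by (intro mult_left_mono) (simp_all add: m_def B_def emB[unfolded B_def])
      also have "\<dots> = (\<integral>\<^sup>+w. ennreal (P / (m / 2)) * (ennreal (cmod (h w)) * indicator B w) \<partial>lborel)"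
        by (rule nn_integral_cmult[symmetric]) simp
      also have "\<dots> \<le> (\<integral>\<^sup>+w. ennreal (\<Phi> (cmod (h w))) * indicator B w + ennreal P * indicator B w \<partial>lborel)"
      proof (rule nn_integral_mono)
        fix w
        have "ennreal (P / (m / 2)) * ennreal (cmod (h w)) \<le> ennreal (\<Phi> (cmod (h w))) + ennreal P"
          using tangent_bound[of "m / 2" "cmod (h w)"] m P
          by (simp add: P_def nonneg ennreal_leI flip: ennreal_mult ennreal_plus)
        then show "ennreal (P / (m / 2)) * (ennreal (cmod (h w)) * indicator B w)
            \<le> ennreal (\<Phi> (cmod (h w))) * indicator B w + ennreal P * indicator B w"
          by (auto simp: indicator_def)
      qed
      also have "\<dots> = X + ennreal P * ennreal b"
        unfolding X_def emB[symmetric]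
        by (subst nn_integral_add) (auto simp: nn_integral_cmult_indicator)
      also have "X \<le> ennreal (1 / (c * y powr \<gamma>)) * modular \<Phi> \<gamma> h"
      proof -
        have "X \<le> (\<integral>\<^sup>+w. ennreal (1 / (c * y powr \<gamma>)) *
            (ennreal (\<Phi> (cmod (h w)) * Im w powr \<gamma>) * indicator UHP w) \<partial>lborel)"
          unfolding X_def
        proof (rule nn_integral_mono)
          fix w
          show "ennreal (\<Phi> (cmod (h w))) * indicator B w \<le> ennreal (1 / (c * y powr \<gamma>)) *
            (ennreal (\<Phi> (cmod (h w)) * Im w powr \<gamma>) * indicator UHP w)"
          proof (cases "w \<in> B")
            case True
            have "c * y powr \<gamma> \<le> Im w powr \<gamma>"
              unfolding c_def using y Im[OF True] by (intro powr_ge_within_half) auto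
            then have "\<Phi> (cmod (h w)) * (c * y powr \<gamma>) \<le> \<Phi> (cmod (h w)) * Im w powr \<gamma>"
              by (intro mult_left_mono nonneg) auto
            then have "\<Phi> (cmod (h w)) \<le> 1 / (c * y powr \<gamma>) * (\<Phi> (cmod (h w)) * Im w powr \<gamma>)"
              using c y by (simp add: pos_le_divide_eq)
            then have "ennreal (\<Phi> (cmod (h w))) \<le>
                ennreal (1 / (c * y powr \<gamma>)) * ennreal (\<Phi> (cmod (h w)) * Im w powr \<gamma>)"
              using c by (subst ennreal_mult[symmetric]) (auto intro!: ennreal_leI simp: nonneg)
            then show ?thesis
              using True B by (auto simp: indicator_def)
          qed simp
        qed
        also have "\<dots> = ennreal (1 / (c * y powr \<gamma>)) * modular \<Phi> \<gamma> h"
          unfolding modular_def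
          using modular_integrand_measurable[OF cont] by (intro nn_integral_cmult) simp
        finally show ?thesis .
      qed
      also have "\<dots> \<le> ennreal (1 / (c * y powr \<gamma>)) * 1"
        by (intro mult_left_mono mod) auto
      finally have "ennreal (2 * P * b) \<le> ennreal (1 / (c * y powr \<gamma>) + P * b)"
        using P b c by (simp add: add_right_mono flip: ennreal_mult ennreal_plus)
      then have "2 * P * b \<le> 1 / (c * y powr \<gamma>) + P * b"
        using P b c by (subst (asm) ennreal_le_iff) auto
      then have P_le: "P \<le> 1 / (c * y powr \<gamma>) / b"
        using b by (subst pos_le_divide_eq) auto
      have "y powr (2 + \<gamma>) = y\<^sup>2 * y powr \<gamma>"
        using y by (simp add: powr_add)
      then have "1 / (c * y powr \<gamma>) / b = 4 / (pi * c) * (1 / y powr (2 + \<gamma>))"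
        by (simp add: b_def power_divide)
      with P_le have "P \<le> 4 / (pi * c) * (1 / y powr (2 + \<gamma>))"
        by simp
      also have "\<dots> \<le> D * (1 / y powr (2 + \<gamma>))"
        by (intro mult_right_mono) (auto simp: D_def)
      finally have "\<Phi> (m / 2) / D \<le> 1 / y powr (2 + \<gamma>)"
        using D by (simp add: P_def pos_divide_le_eq mult.commute)
      then have "\<Phi> (m / 2 / D) \<le> 1 / y powr (2 + \<gamma>)"
        using divide_le[of D "m / 2"] D m by simp
      then have "m / 2 / D \<le> Y"
        unfolding Y_def using y by (intro le_ginv) auto
      then have "m \<le> 2 * D * Y"
        using D by (simp add: pos_divide_le_eq mult_ac)
      then show ?thesis
        by (simp only: m_def Y_def y_def)
    qed
  qed
  then show ?thesis
    using D by (intro exI[of _ "2 * D"]) auto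
qed

subsection \<open>Test functions\<close>

text \<open>The arctangent settles the right half-line and reflection the left one. Counting 0 twice
  does no harm to an upper bound.\<close>

lemma nn_integral_inverse_1_plus_square_finite:
  "(\<integral>\<^sup>+x. ennreal (1 / (1 + x\<^sup>2)) \<partial>lborel) < \<infinity>"
proof -
  define A where "A = (\<lambda>x::real. ennreal (1 / (1 + x\<^sup>2)))"
  have [measurable]: "A \<in> borel_measurable borel" unfolding A_def by measurable
  have "(\<integral>\<^sup>+x. A x * indicator {0..} x \<partial>lborel) = ennreal (pi / 2 - arctan 0)"
    unfolding A_def
    by (rule nn_integral_FTC_atLeast)
      (auto intro!: derivative_eq_intros tendsto_arctan_at_top simp: field_simps)
  then have 1: "(\<integral>\<^sup>+x. A x * indicator {0..} x \<partial>lborel) < \<infinity>" by simp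
  have "(\<integral>\<^sup>+x. A x * indicator {..0} x \<partial>lborel) =
      ennreal \<bar>-1\<bar> * (\<integral>\<^sup>+x. A (0 + (-1) * x) * indicator {..0} (0 + (-1) * x) \<partial>lborel)"
    by (rule nn_integral_real_affine) auto
  also have "\<dots> = (\<integral>\<^sup>+x. A x * indicator {0..} x \<partial>lborel)"
    by (simp add: A_def indicator_def)
  finally have 2: "(\<integral>\<^sup>+x. A x * indicator {..0} x \<partial>lborel) < \<infinity>" using 1 by simp
  have "(\<integral>\<^sup>+x. A x \<partial>lborel) \<le> (\<integral>\<^sup>+x. A x * indicator {0..} x + A x * indicator {..0} x \<partial>lborel)"
    by (intro nn_integral_mono) (auto simp: indicator_def)
  also have "\<dots> = (\<integral>\<^sup>+x. A x * indicator {0..} x \<partial>lborel) + (\<integral>\<^sup>+x. A x * indicator {..0} x \<partial>lborel)"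
    by (rule nn_integral_add) auto
  also have "\<dots> < \<infinity>" using 1 2 by simp
  finally show ?thesis by (simp add: A_def)
qed

text \<open>Near 0 the integrand is dominated by \<open>y powr \<gamma>\<close>, integrable as
  \<open>\<gamma> > -1\<close>; beyond 1 it is dominated by \<open>y powr (-2)\<close> by the choice
  of \<open>n\<close>.\<close>

lemma nn_integral_powr_div_power_finite:
  fixes \<gamma> :: real
  assumes \<gamma>: "\<gamma> > -1" and n: "real n \<ge> \<gamma> + 2"
  shows "(\<integral>\<^sup>+y. ennreal (y powr \<gamma> / (1 + y) ^ n) * indicator {0<..} y \<partial>lborel) < \<infinity>"
proof -
  have 1: "(\<integral>\<^sup>+y. ennreal (indicator {0..1} y * y powr \<gamma>) \<partial>lborel) < \<infinity>"
    using nn_integral_has_integral_lebesgue[OF _ has_integral_powr_from_0[OF \<gamma>, of 1]] by simp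
  have 2: "(\<integral>\<^sup>+y. ennreal (indicator {1..} y * y powr (-2)) \<partial>lborel) < \<infinity>"
    using nn_integral_has_integral_lebesgue[OF _ has_integral_powr_to_inf[of "-2" 1]] by simp
  have "(\<integral>\<^sup>+y. ennreal (y powr \<gamma> / (1 + y) ^ n) * indicator {0<..} y \<partial>lborel) \<le>
     (\<integral>\<^sup>+y. ennreal (indicator {0..1} y * y powr \<gamma>) + ennreal (indicator {1..} y * y powr (-2)) \<partial>lborel)"
  proof (rule nn_integral_mono)
    fix y :: real
    consider "y \<le> 0" | "0 < y" "y \<le> 1" | "1 < y" by linarith
    then show "ennreal (y powr \<gamma> / (1 + y) ^ n) * indicator {0<..} y \<le>
        ennreal (indicator {0..1} y * y powr \<gamma>) + ennreal (indicator {1..} y * y powr (-2))"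
    proof cases
      case 2
      then have "y powr \<gamma> / (1 + y) ^ n \<le> y powr \<gamma> / 1"
        by (intro divide_left_mono) auto
      then have "ennreal (y powr \<gamma> / (1 + y) ^ n) \<le> ennreal (y powr \<gamma>)"
        by (intro ennreal_leI) simp
      from add_increasing2[OF zero_le this] show ?thesis using 2 by simp
    next
      case 3
      have "y powr \<gamma> / (1 + y) ^ n \<le> y powr \<gamma> / y ^ n"
        using 3 by (intro divide_left_mono power_mono) auto
      also have "\<dots> = y powr (\<gamma> - real n)"
        using 3 by (simp add: powr_diff powr_realpow)
      also have "\<dots> \<le> y powr (-2)"
        using 3 n by (intro powr_mono) auto
      finally have "ennreal (y powr \<gamma> / (1 + y) ^ n) \<le> ennreal (y powr (-2))"
        by (rule ennreal_leI)
      then show ?thesis using 3 by (auto simp: indicator_def)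
    qed simp
  qed
  also have "\<dots> = (\<integral>\<^sup>+y. ennreal (indicator {0..1} y * y powr \<gamma>) \<partial>lborel) +
      (\<integral>\<^sup>+y. ennreal (indicator {1..} y * y powr (-2)) \<partial>lborel)"
    by (rule nn_integral_add) auto
  also have "\<dots> < \<infinity>" using 1 2 by simp
  finally show ?thesis .
qed

text \<open>In the coordinates \<open>u = (Re w - Re z) / s\<close> and \<open>v = Im w / s\<close>,
  with \<open>s = Im z\<close>, the distance to \<open>cnj z\<close> is \<open>s * d\<close> with
  \<open>d\<^sup>2 = u\<^sup>2 + (1 + v)\<^sup>2\<close>. Two of the \<open>2 + n\<close> factors
  \<open>1 / d\<close> pay for integrability in \<open>u\<close>, the other \<open>n\<close> for
  that in \<open>v\<close>, so the majorant is a product. The Jacobian \<open>s\<^sup>2\<close> and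
  the weight \<open>s powr \<gamma>\<close> give the power of \<open>Im z\<close>.\<close>

lemma kernel_integral_bound:
  fixes \<gamma> :: real
  assumes \<gamma>: "\<gamma> > -1"
  shows "\<exists>k K. k \<ge> 1 \<and> K \<ge> 0 \<and> (\<forall>z\<in>UHP.
    (\<integral>\<^sup>+w. ennreal ((Im z / cmod (w - cnj z)) ^ k * Im w powr \<gamma>) * indicator UHP w \<partial>lborel)
      \<le> ennreal (K * Im z powr (2 + \<gamma>)))"
proof -
  obtain n :: nat where n: "real n \<ge> \<gamma> + 2" using real_arch_simple by blast
  define A where "A = (\<lambda>x::real. ennreal (1 / (1 + x\<^sup>2)))"
  define B where "B = (\<lambda>y::real. ennreal (y powr \<gamma> / (1 + y) ^ n) * indicator {0<..} y)"
  have [measurable]: "A \<in> borel_measurable borel" "B \<in> borel_measurable borel"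
    unfolding A_def B_def by measurable
  define I where "I = (\<integral>\<^sup>+x. A x \<partial>lborel) * (\<integral>\<^sup>+y. B y \<partial>lborel)"
  have "I < \<infinity>"
    unfolding I_def A_def B_def
    using nn_integral_inverse_1_plus_square_finite nn_integral_powr_div_power_finite[OF \<gamma> n]
    by (simp add: ennreal_mult_less_top)
  then have I: "I = ennreal (enn2real I)" by simp
  have "(\<integral>\<^sup>+w. ennreal ((Im z / cmod (w - cnj z)) ^ (2 + n) * Im w powr \<gamma>) * indicator UHP w \<partial>lborel)
      \<le> ennreal (enn2real I * Im z powr (2 + \<gamma>))" if z: "z \<in> UHP" for z
  proof -
    define s where "s = Im z"
    define a where "a = Re z"
    have s: "s > 0" using z by (simp add: s_def UHP_def)
    have scale: "(\<integral>\<^sup>+x. g ((x - b) / s) \<partial>lborel) = ennreal s * (\<integral>\<^sup>+x. g x \<partial>lborel)"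
      if [measurable]: "g \<in> borel_measurable borel" for g :: "real \<Rightarrow> ennreal" and b
      using s by (subst nn_integral_real_affine[where c = s and t = b]) auto
    have "(\<integral>\<^sup>+w. ennreal ((s / cmod (w - cnj z)) ^ (2 + n) * Im w powr \<gamma>) * indicator UHP w \<partial>lborel)
        \<le> (\<integral>\<^sup>+w. ennreal (s powr \<gamma>) * (A ((Re w - a) / s) * B ((Im w - 0) / s)) \<partial>lborel)"
    proof (rule nn_integral_mono)
      fix w :: complex
      show "ennreal ((s / cmod (w - cnj z)) ^ (2 + n) * Im w powr \<gamma>) * indicator UHP w
          \<le> ennreal (s powr \<gamma>) * (A ((Re w - a) / s) * B ((Im w - 0) / s))"
      proof (cases "w \<in> UHP")
        case True
        define u where "u = (Re w - a) / s"
        define v where "v = Im w / s"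
        have v: "v > 0" using True s by (simp add: v_def UHP_def)
        define d where "d = cmod (w - cnj z) / s"
        have eqs: "Re (w - cnj z) = s * u" "Im (w - cnj z) = s * (1 + v)"
          using s by (simp_all add: u_def v_def a_def s_def field_simps)
        have "(cmod (w - cnj z))\<^sup>2 = s\<^sup>2 * (u\<^sup>2 + (1 + v)\<^sup>2)"
          unfolding cmod_power2 eqs by (simp add: power2_eq_square algebra_simps)
        then have d2: "d\<^sup>2 = u\<^sup>2 + (1 + v)\<^sup>2"
          using s by (simp add: d_def power_divide)
        have d1: "1 + v \<le> d"
        proof (rule power2_le_imp_le)
          show "(1 + v)\<^sup>2 \<le> d\<^sup>2" by (simp add: d2)
          show "0 \<le> d" using s by (simp add: d_def)
        qed
        have "1 + u\<^sup>2 \<le> d\<^sup>2"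
          unfolding d2 using v by (simp add: one_le_power)
        then have "1 / d\<^sup>2 \<le> 1 / (1 + u\<^sup>2)"
          using d1 v by (intro divide_left_mono mult_pos_pos) (auto simp: add_pos_nonneg)
        moreover have "1 / d ^ n \<le> 1 / (1 + v) ^ n"
          using d1 v by (intro divide_left_mono power_mono mult_pos_pos) auto
        ultimately have "1 / d\<^sup>2 * (1 / d ^ n) \<le> 1 / (1 + u\<^sup>2) * (1 / (1 + v) ^ n)"
          using d1 v by (intro mult_mono) auto
        then have "1 / d\<^sup>2 * (1 / d ^ n) * (s powr \<gamma> * v powr \<gamma>) \<le>
            1 / (1 + u\<^sup>2) * (1 / (1 + v) ^ n) * (s powr \<gamma> * v powr \<gamma>)"
          by (intro mult_right_mono) auto
        moreover have "(s / cmod (w - cnj z)) ^ (2 + n) = 1 / d\<^sup>2 * (1 / d ^ n)"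
          by (simp add: d_def power_divide power2_eq_square)
        moreover have "Im w powr \<gamma> = s powr \<gamma> * v powr \<gamma>"
          using s v by (simp add: v_def powr_divide)
        ultimately have "(s / cmod (w - cnj z)) ^ (2 + n) * Im w powr \<gamma> \<le>
            s powr \<gamma> * (1 / (1 + u\<^sup>2) * (v powr \<gamma> / (1 + v) ^ n))"
          by (simp add: mult_ac)
        then have "ennreal ((s / cmod (w - cnj z)) ^ (2 + n) * Im w powr \<gamma>) \<le>
            ennreal (s powr \<gamma> * (1 / (1 + u\<^sup>2) * (v powr \<gamma> / (1 + v) ^ n)))"
          by (rule ennreal_leI)
        also have "\<dots> = ennreal (s powr \<gamma>) * (A u * B v)"
          using v by (simp add: A_def B_def flip: ennreal_mult)
        finally show ?thesis using True by (simp add: u_def v_def)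
      qed simp
    qed
    also have "\<dots> = ennreal (s powr \<gamma>) * (\<integral>\<^sup>+w. A ((Re w - a) / s) * B ((Im w - 0) / s) \<partial>lborel)"
      by (rule nn_integral_cmult) measurable
    also have "(\<integral>\<^sup>+w. A ((Re w - a) / s) * B ((Im w - 0) / s) \<partial>lborel) =
        (\<integral>\<^sup>+x. \<integral>\<^sup>+y. A ((x - a) / s) * B ((y - 0) / s) \<partial>lborel \<partial>lborel)"
      by (subst nn_integral_complex(1)) auto
    also have "\<dots> = (\<integral>\<^sup>+x. A ((x - a) / s) * (\<integral>\<^sup>+y. B ((y - 0) / s) \<partial>lborel) \<partial>lborel)"
      by (intro nn_integral_cong nn_integral_cmult) measurable
    also have "\<dots> = (\<integral>\<^sup>+x. A ((x - a) / s) \<partial>lborel) * (\<integral>\<^sup>+y. B ((y - 0) / s) \<partial>lborel)"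
      by (intro nn_integral_multc) measurable
    also have "\<dots> = (ennreal s * (\<integral>\<^sup>+x. A x \<partial>lborel)) * (ennreal s * (\<integral>\<^sup>+y. B y \<partial>lborel))"
      by (simp only: scale \<open>A \<in> borel_measurable borel\<close> \<open>B \<in> borel_measurable borel\<close>)
    also have "\<dots> = ennreal (s\<^sup>2) * I"
      using s by (simp add: I_def power2_eq_square ennreal_mult mult_ac)
    also have "ennreal (s powr \<gamma>) * \<dots> = ennreal (enn2real I * s powr (2 + \<gamma>))"
    proof -
      have "s powr (2 + \<gamma>) = s powr \<gamma> * s\<^sup>2"
        using s by (simp add: powr_add)
      then show ?thesis
        by (subst I) (simp add: ennreal_mult mult_ac)
    qed
    finally show ?thesis by (simp add: s_def)
  qed
  then show ?thesis
    by (intro exI[of _ "2 + n"] exI[of _ "enn2real I"]) auto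
qed

text \<open>The kernel \<open>s / (w - cnj z)\<close> with \<open>s = Im z\<close> has its pole
  outside \<open>UHP\<close> and modulus at most 1 there, so \<open>contract\<close> pulls its power
  out of \<open>\<Phi>\<close>. The height \<open>T\<close> is chosen so that
  \<open>\<Phi> T\<close> cancels the power of \<open>s\<close> in the kernel integral, which makes
  the norm bound uniform in \<open>z\<close>. At \<open>w = z\<close> the kernel has modulus 1/2,
  whence the constant \<open>(1 / 2) ^ k\<close>.\<close>

lemma (in growth) test_functions:
  assumes \<gamma>: "\<gamma> > -1"
  shows "\<exists>c>0. \<exists>M>0. \<forall>z\<in>UHP. \<exists>f\<in>bergman_orlicz \<Phi> \<gamma>.
    cmod (f z) = c * ginv \<Phi> (1 / Im z powr (2 + \<gamma>)) \<and> lux_norm \<Phi> \<gamma> f \<le> M"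
proof -
  obtain k K where k: "k \<ge> 1" and K: "K \<ge> 0" and bound: "\<And>z. z \<in> UHP \<Longrightarrow>
      (\<integral>\<^sup>+w. ennreal ((Im z / cmod (w - cnj z)) ^ k * Im w powr \<gamma>) * indicator UHP w \<partial>lborel)
      \<le> ennreal (K * Im z powr (2 + \<gamma>))"
    using kernel_integral_bound[OF \<gamma>] by blast
  define M where "M = max 1 K"
  have M: "M \<ge> 1" by (simp add: M_def)
  have "\<exists>f\<in>bergman_orlicz \<Phi> \<gamma>.
      cmod (f z) = (1 / 2) ^ k * ginv \<Phi> (1 / Im z powr (2 + \<gamma>)) \<and> lux_norm \<Phi> \<gamma> f \<le> M"
    if z: "z \<in> UHP" for z
  proof -
    define s where "s = Im z"
    have s: "s > 0" using z by (simp add: s_def UHP_def)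
    define T where "T = ginv \<Phi> (1 / s powr (2 + \<gamma>))"
    have T: "T > 0" "\<Phi> T = 1 / s powr (2 + \<gamma>)"
      unfolding T_def using s by (auto intro!: ginv_pos ginv_right)
    define f where "f = (\<lambda>w. of_real T * (of_real s / (w - cnj z)) ^ k)"
    have ge: "s \<le> cmod (w - cnj z)" if "w \<in> UHP" for w
    proof -
      have "s \<le> Im (w - cnj z)" using that by (simp add: s_def UHP_def)
      also have "\<dots> \<le> cmod (w - cnj z)" using abs_Im_le_cmod[of "w - cnj z"] by linarith
      finally show ?thesis .
    qed
    have hol: "f holomorphic_on UHP"
      unfolding f_def using ge s by (intro holomorphic_intros) force
    have f_eq: "cmod (f w) = (s / cmod (w - cnj z)) ^ k * T" for w
      using T s by (simp add: f_def norm_mult norm_power norm_divide)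
    have le: "\<Phi> (cmod (f w)) \<le> 1 / s powr (2 + \<gamma>) * (s / cmod (w - cnj z)) ^ k" if "w \<in> UHP" for w
    proof -
      have "(s / cmod (w - cnj z)) ^ k \<le> 1"
        using ge[OF that] s by (intro power_le_one) (auto simp: divide_le_eq_1)
      then show ?thesis
        using contract[of "(s / cmod (w - cnj z)) ^ k" T] T s by (simp add: f_eq)
    qed
    have "UHP \<in> sets borel" using open_UHP by (rule borel_open)
    then have [measurable]: "indicator UHP \<in> borel_measurable borel" by (rule borel_measurable_indicator)
    have "modular \<Phi> \<gamma> f \<le> (\<integral>\<^sup>+w. ennreal (1 / s powr (2 + \<gamma>)) *
        (ennreal ((s / cmod (w - cnj z)) ^ k * Im w powr \<gamma>) * indicator UHP w) \<partial>lborel)"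
      unfolding modular_def
    proof (rule nn_integral_mono)
      fix w
      show "ennreal (\<Phi> (cmod (f w)) * Im w powr \<gamma>) * indicator UHP w \<le> ennreal (1 / s powr (2 + \<gamma>)) *
        (ennreal ((s / cmod (w - cnj z)) ^ k * Im w powr \<gamma>) * indicator UHP w)"
      proof (cases "w \<in> UHP")
        case True
        have "\<Phi> (cmod (f w)) * Im w powr \<gamma> \<le>
            1 / s powr (2 + \<gamma>) * (s / cmod (w - cnj z)) ^ k * Im w powr \<gamma>"
          by (intro mult_right_mono le True) auto
        then show ?thesis
          using True s by (simp add: ennreal_leI mult.assoc flip: ennreal_mult)
      qed simp
    qed
    also have "\<dots> = ennreal (1 / s powr (2 + \<gamma>)) * (\<integral>\<^sup>+w.
        ennreal ((s / cmod (w - cnj z)) ^ k * Im w powr \<gamma>) * indicator UHP w \<partial>lborel)"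
      by (rule nn_integral_cmult) measurable
    also have "\<dots> \<le> ennreal (1 / s powr (2 + \<gamma>)) * ennreal (K * s powr (2 + \<gamma>))"
      using bound[OF z] by (intro mult_left_mono) (auto simp: s_def)
    also have "\<dots> = ennreal K"
      using s K by (simp flip: ennreal_mult)
    also have "\<dots> \<le> ennreal M" by (intro ennreal_leI) (simp add: M_def)
    finally have mod: "modular \<Phi> \<gamma> f \<le> ennreal M" .
    then have "f \<in> bergman_orlicz \<Phi> \<gamma>"
      using hol by (auto simp: bergman_orlicz_def intro: le_less_trans)
    moreover have "lux_norm \<Phi> \<gamma> f \<le> M"
      using M mod hol by (intro lux_norm_le modular_divide_le_1 holomorphic_on_imp_continuous_on) auto
    moreover have "cmod (f z) = (1 / 2) ^ k * T"
    proof -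
      have "z - cnj z = of_real (2 * s) * \<i>" by (simp add: complex_eq_iff s_def)
      then have "cmod (z - cnj z) = 2 * s" using s by (simp add: norm_mult)
      then show ?thesis using s by (simp add: f_eq)
    qed
    ultimately show ?thesis unfolding T_def s_def by blast
  qed
  then show ?thesis
    using M by (intro exI[of _ "(1 / 2) ^ k"] conjI exI[of _ M]) auto
qed

subsection \<open>The multiplier space\<close>

lemma U_tildeE:
  assumes "\<Phi> \<in> U_tilde"
  obtains q C1 C2 C3 where "growth \<Phi> q"
    and "C1 > 0" "\<And>s t. s > 0 \<Longrightarrow> t > 0 \<Longrightarrow> \<Phi> (s * t) \<le> C1 * \<Phi> s * \<Phi> t"
    and "C2 > 0" "\<And>a b. a \<ge> 1 \<Longrightarrow> b \<ge> 1 \<Longrightarrow> \<Phi> (a / b) \<le> C2 * \<Phi> a / b powr q"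
    and "C3 > 0" "\<And>a b. 0 < a \<Longrightarrow> a \<le> b \<Longrightarrow> b \<le> 1 \<Longrightarrow> \<Phi> (a / b) \<le> C3 * \<Phi> a / \<Phi> b"
proof -
  obtain q where U: "\<Phi> \<in> U_q q"
    and E1: "\<exists>C1>0. \<forall>s>0. \<forall>t>0. \<Phi> (s * t) \<le> C1 * \<Phi> s * \<Phi> t"
    and E2: "\<exists>C2>0. \<forall>a\<ge>1. \<forall>b\<ge>1. \<Phi> (a / b) \<le> C2 * \<Phi> a / b powr q"
    and E3: "\<exists>C3>0. \<forall>a b. 0 < a \<and> a \<le> b \<and> b \<le> 1 \<longrightarrow> \<Phi> (a / b) \<le> C3 * \<Phi> a / \<Phi> b"
    using assms unfolding U_tilde_def mem_Collect_eq
    by (rule exE) (elim conjE, rule that, assumption+)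
  obtain C1 where C1: "C1 > 0" "\<And>s t. s > 0 \<Longrightarrow> t > 0 \<Longrightarrow> \<Phi> (s * t) \<le> C1 * \<Phi> s * \<Phi> t"
    using E1 by auto
  obtain C2 where C2: "C2 > 0" "\<And>a b. a \<ge> 1 \<Longrightarrow> b \<ge> 1 \<Longrightarrow> \<Phi> (a / b) \<le> C2 * \<Phi> a / b powr q"
    using E2 by auto
  obtain C3 where C3: "C3 > 0" "\<And>a b. 0 < a \<Longrightarrow> a \<le> b \<Longrightarrow> b \<le> 1 \<Longrightarrow> \<Phi> (a / b) \<le> C3 * \<Phi> a / \<Phi> b"
    using E3 by auto
  show thesis
    by (rule that[OF growth.intro[OF U] C1 C2 C3])
qed

text \<open>The class controls quotients only when both arguments lie on the same side of 1. Above 1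
  the upper type inequality converts \<open>1 / T powr q\<close> into a multiple of
  \<open>1 / \<Phi> T\<close>. In the mixed case \<open>a < 1 < T\<close>, submultiplicativity
  splits off \<open>\<Phi> a\<close>, and the quotient \<open>1 / T\<close> is handled as above
  1.\<close>

lemma U_tilde_quotient:
  assumes \<Phi>: "\<Phi> \<in> U_tilde"
  shows "\<exists>D>0. \<forall>a T. 0 < a \<longrightarrow> a \<le> T \<longrightarrow> \<Phi> (a / T) \<le> D * (\<Phi> a / \<Phi> T)"
proof -
  obtain q C1 C2 C3 where growth: "growth \<Phi> q"
    and C1: "C1 > 0" "\<And>s t. s > 0 \<Longrightarrow> t > 0 \<Longrightarrow> \<Phi> (s * t) \<le> C1 * \<Phi> s * \<Phi> t"
    and C2: "C2 > 0" "\<And>a b. a \<ge> 1 \<Longrightarrow> b \<ge> 1 \<Longrightarrow> \<Phi> (a / b) \<le> C2 * \<Phi> a / b powr q"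
    and C3: "C3 > 0" "\<And>a b. 0 < a \<Longrightarrow> a \<le> b \<Longrightarrow> b \<le> 1 \<Longrightarrow> \<Phi> (a / b) \<le> C3 * \<Phi> a / \<Phi> b"
    by (rule U_tildeE[OF \<Phi>]) (rule that)
  interpret growth \<Phi> q by (rule growth)
  note C = C1(1) C2(1) C3(1)
  obtain C where C0: "C > 0" and upper: "\<And>s t. s \<ge> 0 \<Longrightarrow> t \<ge> 1 \<Longrightarrow> \<Phi> (s * t) \<le> C * t powr q * \<Phi> s"
    using upper_type by blast
  have \<Phi>1: "\<Phi> 1 > 0" using pos by simp
  have inv: "1 / T powr q \<le> C * \<Phi> 1 / \<Phi> T" if "T \<ge> 1" for T
    using upper[of 1 T] that pos[of T] by (simp add: field_simps)
  \<comment> \<open>\<open>D1\<close> serves the case \<open>1 \<le> a\<close>, \<open>D2\<close>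
    the mixed case and \<open>C3\<close> the case \<open>T \<le> 1\<close>; their sum serves all
    three.\<close>
  define D1 where "D1 = C2 * (C * \<Phi> 1)"
  define D2 where "D2 = C1 * (C2 * \<Phi> 1 * (C * \<Phi> 1))"
  have D: "D1 > 0" "D2 > 0" using C C0 \<Phi>1 by (auto simp: D1_def D2_def)
  have "\<Phi> (a / T) \<le> (C3 + D1 + D2) * (\<Phi> a / \<Phi> T)" if a: "0 < a" "a \<le> T" for a T
  proof -
    have pa: "\<Phi> a > 0" and pT: "\<Phi> T > 0" using pos a by auto
    have r: "\<Phi> a / \<Phi> T > 0" using pa pT by simp
    consider "T \<le> 1" | "1 \<le> a" | "a < 1" "1 < T" by linarith
    then show ?thesis
    proof cases
      case 1
      have "\<Phi> (a / T) \<le> C3 * (\<Phi> a / \<Phi> T)" using C3(2)[of a T] a 1 by simp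
      also have "\<dots> \<le> (C3 + D1 + D2) * (\<Phi> a / \<Phi> T)"
        using r D C by (intro mult_right_mono) auto
      finally show ?thesis .
    next
      case 2
      have "\<Phi> (a / T) \<le> C2 * \<Phi> a * (1 / T powr q)" using C2(2)[of a T] a 2 by simp
      also have "\<dots> \<le> C2 * \<Phi> a * (C * \<Phi> 1 / \<Phi> T)"
        using inv[of T] a 2 C pa by (intro mult_left_mono) auto
      also have "\<dots> = D1 * (\<Phi> a / \<Phi> T)" by (simp add: D1_def)
      also have "\<dots> \<le> (C3 + D1 + D2) * (\<Phi> a / \<Phi> T)"
        using r D C by (intro mult_right_mono) auto
      finally show ?thesis .
    next
      case 3
      have "\<Phi> (1 / T) \<le> C2 * \<Phi> 1 * (1 / T powr q)" using C2(2)[of 1 T] 3 by simp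
      also have "\<dots> \<le> C2 * \<Phi> 1 * (C * \<Phi> 1 / \<Phi> T)"
        using inv[of T] 3 C \<Phi>1 by (intro mult_left_mono) auto
      finally have "C1 * \<Phi> a * \<Phi> (1 / T) \<le> C1 * \<Phi> a * (C2 * \<Phi> 1 * (C * \<Phi> 1 / \<Phi> T))"
        using C pa by (intro mult_left_mono) auto
      then have "\<Phi> (a / T) \<le> C1 * \<Phi> a * (C2 * \<Phi> 1 * (C * \<Phi> 1 / \<Phi> T))"
        using C1(2)[of a "1 / T"] a by simp
      also have "\<dots> = D2 * (\<Phi> a / \<Phi> T)" by (simp add: D2_def)
      also have "\<dots> \<le> (C3 + D1 + D2) * (\<Phi> a / \<Phi> T)"
        using r D C by (intro mult_right_mono) auto
      finally show ?thesis .
    qed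
  qed
  moreover have "C3 + D1 + D2 > 0" using C D by simp
  ultimately show ?thesis by blast
qed

lemma lux_norm_less_ex:
  assumes "r > 0" "modular \<Phi> \<gamma> (\<lambda>z. f z / of_real r) \<le> 1" "lux_norm \<Phi> \<gamma> f < L"
  shows "\<exists>s>0. s < L \<and> modular \<Phi> \<gamma> (\<lambda>z. f z / of_real s) \<le> 1"
proof -
  have "\<exists>s\<in>{r. r > 0 \<and> modular \<Phi> \<gamma> (\<lambda>z. f z / of_real r) \<le> 1}. s < L"
    using assms by (intro cInf_lessD[of _ L, folded Bex_def]) (auto simp: lux_norm_def)
  then show ?thesis by blast
qed

lemma bergman_orlicz_continuous: "f \<in> bergman_orlicz \<Phi> \<gamma> \<Longrightarrow> continuous_on UHP f"
  by (auto simp: bergman_orlicz_def intro: holomorphic_on_imp_continuous_on)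

text \<open>The test function for \<open>z\<close> has norm at most \<open>M\<close>, so its product
  with \<open>g\<close> has norm at most \<open>C * M\<close>. The pointwise bound for
  \<open>\<Phi>2\<close> at \<open>z\<close>, divided by the known value \<open>c * T1\<close> of
  the test function, leaves the bound on \<open>g z\<close>.\<close>

lemma multiplier_bound:
  assumes \<Phi>1: "growth \<Phi>1 q1" and \<Phi>2: "growth \<Phi>2 q2" and \<alpha>: "\<alpha> > -1"
    and g: "g \<in> multipliers \<Phi>1 \<alpha> \<Phi>2 \<beta>"
  shows "\<exists>C. \<forall>z\<in>UHP. cmod (g z) \<le>
    C * (ginv \<Phi>2 (1 / Im z powr (2 + \<beta>)) / ginv \<Phi>1 (1 / Im z powr (2 + \<alpha>)))"
proof -
  interpret G1: growth \<Phi>1 q1 by fact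
  interpret G2: growth \<Phi>2 q2 by fact
  obtain C where C: "C > 0" and mult: "\<And>f. f \<in> bergman_orlicz \<Phi>1 \<alpha> \<Longrightarrow>
      (\<lambda>z. f z * g z) \<in> bergman_orlicz \<Phi>2 \<beta> \<and>
      lux_norm \<Phi>2 \<beta> (\<lambda>z. f z * g z) \<le> C * lux_norm \<Phi>1 \<alpha> f"
    using g by (auto simp: multipliers_def)
  obtain c M where c: "c > 0" and M: "M > 0" and test: "\<And>z. z \<in> UHP \<Longrightarrow> \<exists>f\<in>bergman_orlicz \<Phi>1 \<alpha>.
      cmod (f z) = c * ginv \<Phi>1 (1 / Im z powr (2 + \<alpha>)) \<and> lux_norm \<Phi>1 \<alpha> f \<le> M"
    using G1.test_functions[OF \<alpha>] by blast
  obtain P where P: "P > 0" and point: "\<And>h z. h holomorphic_on UHP \<Longrightarrow> modular \<Phi>2 \<beta> h \<le> 1 \<Longrightarrow>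
      z \<in> UHP \<Longrightarrow> cmod (h z) \<le> P * ginv \<Phi>2 (1 / Im z powr (2 + \<beta>))"
    using G2.pointwise_bound by blast
  \<comment> \<open>The summand 1 makes the norm estimate strict, so that an admissible scaling
    below \<open>L\<close> exists whether or not the infimum is attained.\<close>
  define L where "L = C * M + 1"
  have "cmod (g z) \<le> P * L / c * (ginv \<Phi>2 (1 / Im z powr (2 + \<beta>)) / ginv \<Phi>1 (1 / Im z powr (2 + \<alpha>)))"
    if z: "z \<in> UHP" for z
  proof -
    have y: "Im z > 0" using z by (simp add: UHP_def)
    define T1 where "T1 = ginv \<Phi>1 (1 / Im z powr (2 + \<alpha>))"
    define T2 where "T2 = ginv \<Phi>2 (1 / Im z powr (2 + \<beta>))"
    have T: "T1 > 0" "T2 > 0"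
      unfolding T1_def T2_def using y by (auto intro!: G1.ginv_pos G2.ginv_pos)
    obtain f where f: "f \<in> bergman_orlicz \<Phi>1 \<alpha>" "cmod (f z) = c * T1" "lux_norm \<Phi>1 \<alpha> f \<le> M"
      using test[OF z] unfolding T1_def by blast
    define h where "h = (\<lambda>z. f z * g z)"
    have h: "h \<in> bergman_orlicz \<Phi>2 \<beta>" and "lux_norm \<Phi>2 \<beta> h \<le> C * lux_norm \<Phi>1 \<alpha> f"
      using mult[OF f(1)] by (auto simp: h_def)
    moreover have "C * lux_norm \<Phi>1 \<alpha> f \<le> C * M" using f(3) C by simp
    ultimately have lux: "lux_norm \<Phi>2 \<beta> h < L" by (simp add: L_def)
    obtain r where "r > 0" "modular \<Phi>2 \<beta> (\<lambda>z. h z / of_real r) \<le> 1"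
      using G2.modular_divide_le_1_ex[of h \<beta>] h bergman_orlicz_continuous[OF h]
      by (auto simp: bergman_orlicz_def)
    then obtain s where s: "s > 0" "s < L" "modular \<Phi>2 \<beta> (\<lambda>z. h z / of_real s) \<le> 1"
      using lux_norm_less_ex[OF _ _ lux] by blast
    have "(\<lambda>z. h z / of_real s) holomorphic_on UHP"
      using h s(1) by (intro holomorphic_intros) (auto simp: bergman_orlicz_def)
    from point[OF this s(3) z] have "cmod (h z) / s \<le> P * T2"
      using s(1) by (simp add: norm_divide T2_def)
    then have "cmod (h z) \<le> P * T2 * s"
      using s(1) by (simp add: pos_divide_le_eq)
    also have "\<dots> \<le> P * T2 * L"
      using s P T by (intro mult_left_mono) auto
    finally have "cmod (g z) * (c * T1) \<le> P * T2 * L"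
      by (simp add: h_def norm_mult f(2) mult.commute)
    then have "cmod (g z) \<le> P * T2 * L / (c * T1)"
      using c T by (subst pos_le_divide_eq) auto
    then show ?thesis by (simp add: T1_def T2_def mult_ac)
  qed
  then show ?thesis by blast
qed

lemma multiplier_sufficient:
  assumes \<Phi>1: "growth \<Phi>1 q1" and \<Phi>2: "\<Phi>2 \<in> U_tilde"
    and ratio: "mono_on {0<..} (\<lambda>t. \<Phi>2 t / \<Phi>1 t)"
    and g: "g analytic_on UHP"
    and bound: "\<And>z. z \<in> UHP \<Longrightarrow> cmod (g z) \<le>
      C * (ginv \<Phi>2 (1 / Im z powr (2 + \<beta>)) / ginv \<Phi>1 (1 / Im z powr (2 + \<alpha>)))"
  shows "g \<in> multipliers \<Phi>1 \<alpha> \<Phi>2 \<beta>"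
proof -
  obtain q2 E where \<Phi>2': "growth \<Phi>2 q2"
    and E: "E > 0" and sub: "\<And>s t. s > 0 \<Longrightarrow> t > 0 \<Longrightarrow> \<Phi>2 (s * t) \<le> E * \<Phi>2 s * \<Phi>2 t"
    by (rule U_tildeE[OF \<Phi>2]) (rule that)
  interpret G1: growth \<Phi>1 q1 by fact
  interpret G2: growth \<Phi>2 q2 by fact
  obtain D where D: "D > 0" and quot: "\<And>a T. 0 < a \<Longrightarrow> a \<le> T \<Longrightarrow> \<Phi>2 (a / T) \<le> D * (\<Phi>2 a / \<Phi>2 T)"
    using U_tilde_quotient[OF \<Phi>2] by blast
  obtain P where P: "P > 0" and point: "\<And>h z. h holomorphic_on UHP \<Longrightarrow> modular \<Phi>1 \<alpha> h \<le> 1 \<Longrightarrow>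
      z \<in> UHP \<Longrightarrow> cmod (h z) \<le> P * ginv \<Phi>1 (1 / Im z powr (2 + \<alpha>))"
    using G1.pointwise_bound by blast
  obtain U where U: "U > 0" and upper: "\<And>s t. s \<ge> 0 \<Longrightarrow> t \<ge> 1 \<Longrightarrow> \<Phi>2 (s * t) \<le> U * t powr q2 * \<Phi>2 s"
    using G2.upper_type by blast
  have key: "\<Phi>2 (a / T) \<le> D * (\<Phi>1 a / \<Phi>1 T)" if a: "0 < a" "a \<le> T" for a T
  proof -
    have "\<Phi>2 a / \<Phi>1 a \<le> \<Phi>2 T / \<Phi>1 T"
      using ratio a by (auto simp: mono_on_def)
    then have "\<Phi>2 a / \<Phi>2 T \<le> \<Phi>1 a / \<Phi>1 T"
      using a G1.pos[of a] G1.pos[of T] G2.pos[of T] by (simp add: divide_simps mult.commute)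
    then have "D * (\<Phi>2 a / \<Phi>2 T) \<le> D * (\<Phi>1 a / \<Phi>1 T)"
      using D by (intro mult_left_mono) auto
    with quot[OF a] show ?thesis by simp
  qed
  \<comment> \<open>\<open>P'\<close> brings \<open>cmod (h z)\<close> below \<open>T1\<close>,
    \<open>C'\<close> normalises the bound on \<open>g\<close>, and \<open>D'\<close> absorbs the
    constants of submultiplicativity and of \<open>key\<close>. Being at least 1 lets
    \<open>D'\<close> leave the argument by \<open>divide_le\<close> and gives
    \<open>a \<le> cmod (h z)\<close>; as \<open>C\<close> comes without a sign, it also secures
    \<open>C' > 0\<close>.\<close>
  define P' where "P' = max 1 P"
  define C' where "C' = max 1 C"
  define D' where "D' = max 1 (E * D)"
  define K where "K = P' * C' * D'"
  have pos: "P' \<ge> 1" "C' \<ge> 1" "D' \<ge> 1" by (auto simp: P'_def C'_def D'_def)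
  have K: "K > 0" using pos by (simp add: K_def)
  \<comment> \<open>A single \<open>K\<close> works for all admissible \<open>r\<close>. Membership
    of the product and the norm inequality are both read off from this.\<close>
  have main: "modular \<Phi>2 \<beta> (\<lambda>z. f z * g z / of_real (K * r)) \<le> 1"
    if f: "f holomorphic_on UHP" and r: "r > 0" and mod: "modular \<Phi>1 \<alpha> (\<lambda>z. f z / of_real r) \<le> 1" for f r
  proof -
    define h where "h = (\<lambda>z. f z / of_real r)"
    have h: "h holomorphic_on UHP" unfolding h_def using f r by (intro holomorphic_intros) auto
    have "modular \<Phi>2 \<beta> (\<lambda>z. f z * g z / of_real (K * r)) \<le> ennreal 1 * modular \<Phi>1 \<alpha> h"
    proof (rule modular_le_scaled[OF \<Phi>1 holomorphic_on_imp_continuous_on[OF h]])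
      fix z assume z: "z \<in> UHP"
      define y where "y = Im z"
      have y: "y > 0" using z by (simp add: y_def UHP_def)
      define T1 where "T1 = ginv \<Phi>1 (1 / y powr (2 + \<alpha>))"
      define T2 where "T2 = ginv \<Phi>2 (1 / y powr (2 + \<beta>))"
      have T: "T1 > 0" "T2 > 0" "\<Phi>1 T1 = 1 / y powr (2 + \<alpha>)" "\<Phi>2 T2 = 1 / y powr (2 + \<beta>)"
        unfolding T1_def T2_def using y
        by (auto intro!: G1.ginv_pos G2.ginv_pos G1.ginv_right G2.ginv_right)
      define a where "a = cmod (h z) / P'"
      have a0: "a \<ge> 0" using pos by (simp add: a_def)
      have "cmod (h z) \<le> P * T1"
        using point[OF h _ z] mod by (simp add: h_def T1_def y_def)
      also have "\<dots> \<le> P' * T1" using T by (intro mult_right_mono) (auto simp: P'_def)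
      finally have aT: "a \<le> T1" using pos by (simp add: a_def pos_divide_le_eq mult.commute)
      have gz: "cmod (g z) \<le> C' * (T2 / T1)"
      proof -
        have "cmod (g z) \<le> C * (T2 / T1)" using bound[OF z] by (simp add: T1_def T2_def y_def)
        also have "\<dots> \<le> C' * (T2 / T1)" using T by (intro mult_right_mono) (auto simp: C'_def)
        finally show ?thesis .
      qed
      have "cmod (f z * g z / of_real (K * r)) = a / (C' * D') * cmod (g z)"
        using pos r by (simp add: a_def h_def K_def norm_mult norm_divide)
      also have "\<dots> \<le> a / (C' * D') * (C' * (T2 / T1))"
        using gz a0 pos by (intro mult_left_mono) auto
      also have "\<dots> = a / T1 * T2 / D'" using pos by simp
      finally have "\<Phi>2 (cmod (f z * g z / of_real (K * r))) \<le> \<Phi>2 (a / T1 * T2 / D')"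
        by (intro G2.mono) auto
      also have "\<dots> \<le> \<Phi>2 (a / T1 * T2) / D'"
        using pos a0 T by (intro G2.divide_le) auto
      also have "\<dots> \<le> \<Phi>1 a * y powr (2 + \<alpha>) / y powr (2 + \<beta>)"
      proof (cases "a = 0")
        case True
        then show ?thesis by (simp add: G1.zero G2.zero)
      next
        case False
        then have a: "a > 0" using a0 by simp
        have "\<Phi>2 (a / T1 * T2) \<le> E * \<Phi>2 (a / T1) * \<Phi>2 T2"
          using a T by (intro sub) auto
        also have "\<dots> \<le> E * (D * (\<Phi>1 a / \<Phi>1 T1)) * \<Phi>2 T2"
          using a aT E T by (intro mult_right_mono mult_left_mono key) auto
        also have "\<dots> = (E * D) * (\<Phi>1 a * y powr (2 + \<alpha>) / y powr (2 + \<beta>))"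
          by (simp add: T)
        also have "\<dots> \<le> D' * (\<Phi>1 a * y powr (2 + \<alpha>) / y powr (2 + \<beta>))"
          using a0 by (intro mult_right_mono) (auto simp: D'_def G1.nonneg)
        finally show ?thesis
          using pos by (simp add: pos_divide_le_eq mult.commute)
      qed
      \<comment> \<open>The common factor \<open>y\<^sup>2\<close> cancels, leaving exactly the
        quotient of the two weights.\<close>
      also have "\<dots> = \<Phi>1 a * y powr \<alpha> / y powr \<beta>"
        using y by (simp add: powr_add)
      finally have "\<Phi>2 (cmod (f z * g z / of_real (K * r))) * y powr \<beta> \<le> \<Phi>1 a * y powr \<alpha>"
        using y by (simp add: pos_le_divide_eq)
      also have "\<dots> \<le> \<Phi>1 (cmod (h z)) * y powr \<alpha>"
      proof (intro mult_right_mono G1.mono a0)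
        show "a \<le> cmod (h z)" using pos by (simp add: a_def pos_divide_le_eq mult_le_cancel_left1)
      qed auto
      finally show "\<Phi>2 (cmod (f z * g z / of_real (K * r))) * Im z powr \<beta> \<le>
          1 * (\<Phi>1 (cmod (h z)) * Im z powr \<alpha>)"
        by (simp add: y_def)
    qed auto
    also have "\<dots> \<le> 1" using mod by (simp add: h_def)
    finally show ?thesis .
  qed
  have "(\<lambda>z. f z * g z) \<in> bergman_orlicz \<Phi>2 \<beta> \<and>
      lux_norm \<Phi>2 \<beta> (\<lambda>z. f z * g z) \<le> K * lux_norm \<Phi>1 \<alpha> f"
    if f: "f \<in> bergman_orlicz \<Phi>1 \<alpha>" for f
  proof
    have fhol: "f holomorphic_on UHP" using f by (simp add: bergman_orlicz_def)
    have "g holomorphic_on UHP" using g by (rule analytic_imp_holomorphic)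
    with fhol have hol: "(\<lambda>z. f z * g z) holomorphic_on UHP" by (rule holomorphic_on_mult)
    obtain r where r: "r > 0" "modular \<Phi>1 \<alpha> (\<lambda>z. f z / of_real r) \<le> 1"
      using G1.modular_divide_le_1_ex[of f \<alpha>] f bergman_orlicz_continuous[OF f]
      by (auto simp: bergman_orlicz_def)
    \<comment> \<open>Membership concerns the unscaled product, so the division by
      \<open>K * r\<close> is undone with the upper type inequality, which asks for a factor of at
      least 1.\<close>
    define R where "R = max 1 (K * r)"
    have "modular \<Phi>2 \<beta> (\<lambda>z. f z * g z) \<le>
        ennreal (U * R powr q2) * modular \<Phi>2 \<beta> (\<lambda>z. f z * g z / of_real (K * r))"
    proof (rule modular_le_scaled[OF \<Phi>2'])
      show "continuous_on UHP (\<lambda>z. f z * g z / of_real (K * r))"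
        using hol K r by (intro continuous_intros holomorphic_on_imp_continuous_on) auto
      fix z
      define t where "t = cmod (f z * g z / of_real (K * r))"
      have "cmod (f z * g z) = t * (K * r)" using K r by (simp add: t_def norm_divide norm_mult)
      also have "\<dots> \<le> t * R" by (intro mult_left_mono) (auto simp: R_def t_def)
      finally have "\<Phi>2 (cmod (f z * g z)) \<le> \<Phi>2 (t * R)" by (intro G2.mono) auto
      also have "\<dots> \<le> U * R powr q2 * \<Phi>2 t" by (intro upper) (auto simp: t_def R_def)
      finally have "\<Phi>2 (cmod (f z * g z)) * Im z powr \<beta> \<le> U * R powr q2 * \<Phi>2 t * Im z powr \<beta>"
        by (intro mult_right_mono) auto
      then show "\<Phi>2 (cmod (f z * g z)) * Im z powr \<beta> \<le>
          U * R powr q2 * (\<Phi>2 (cmod (f z * g z / of_real (K * r))) * Im z powr \<beta>)"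
        by (simp only: t_def mult.assoc)
    qed (use U in auto)
    also have "\<dots> \<le> ennreal (U * R powr q2) * 1"
      by (intro mult_left_mono main fhol r) auto
    finally show "(\<lambda>z. f z * g z) \<in> bergman_orlicz \<Phi>2 \<beta>"
      using hol by (auto simp: bergman_orlicz_def intro: le_less_trans)
    \<comment> \<open>Each \<open>s\<close> admissible for \<open>f\<close> makes
      \<open>K * s\<close> admissible for the product. With \<open>K\<close> on the left, this is a
      lower bound for the set whose infimum is the norm of \<open>f\<close>.\<close>
    have "lux_norm \<Phi>2 \<beta> (\<lambda>z. f z * g z) / K \<le> lux_norm \<Phi>1 \<alpha> f"
      unfolding lux_norm_def[of \<Phi>1]
    proof (rule cInf_greatest)
      fix s assume "s \<in> {r. r > 0 \<and> modular \<Phi>1 \<alpha> (\<lambda>z. f z / of_real r) \<le> 1}"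
      then have "lux_norm \<Phi>2 \<beta> (\<lambda>z. f z * g z) \<le> K * s"
        using K main[OF fhol, of s] by (intro lux_norm_le) auto
      then show "lux_norm \<Phi>2 \<beta> (\<lambda>z. f z * g z) / K \<le> s"
        using K by (simp add: pos_divide_le_eq mult.commute)
    qed (use r in auto)
    then show "lux_norm \<Phi>2 \<beta> (\<lambda>z. f z * g z) \<le> K * lux_norm \<Phi>1 \<alpha> f"
      using K by (simp add: pos_divide_le_eq mult.commute)
  qed
  then show ?thesis
    using g K unfolding multipliers_def by blast
qed

lemma multipliers_eq_H_infty_weighted:
  assumes "\<Phi>1 \<in> U_class" "\<Phi>2 \<in> U_tilde" "mono_on {0<..} (\<lambda>t. \<Phi>2 t / \<Phi>1 t)" "\<alpha> > -1"
    and \<omega>: "\<And>t. t > 0 \<Longrightarrow>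
       \<omega> t = ginv \<Phi>2 (1 / t powr (2 + \<beta>)) / ginv \<Phi>1 (1 / t powr (2 + \<alpha>))"
  shows "multipliers \<Phi>1 \<alpha> \<Phi>2 \<beta> = H_infty_weighted \<omega>"
proof -
  obtain q1 where "\<Phi>1 \<in> U_q q1" using assms(1) by (auto simp: U_class_def)
  then have 1: "growth \<Phi>1 q1" by unfold_locales
  obtain q2 where 2: "growth \<Phi>2 q2" by (rule U_tildeE[OF assms(2)])
  have \<omega>': "\<omega> (Im z) = ginv \<Phi>2 (1 / Im z powr (2 + \<beta>)) / ginv \<Phi>1 (1 / Im z powr (2 + \<alpha>))"
    if "z \<in> UHP" for z using that by (intro \<omega>) (simp add: UHP_def)
  show ?thesis
  proof (intro equalityI subsetI)
    fix g assume g: "g \<in> multipliers \<Phi>1 \<alpha> \<Phi>2 \<beta>"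
    then have "g analytic_on UHP" by (simp add: multipliers_def)
    moreover have "\<exists>C. \<forall>z\<in>UHP. cmod (g z) \<le> C * \<omega> (Im z)"
      using multiplier_bound[OF 1 2 assms(4) g] by (simp add: \<omega>' cong: ball_cong)
    ultimately show "g \<in> H_infty_weighted \<omega>" by (simp add: H_infty_weighted_def)
  next
    fix g assume "g \<in> H_infty_weighted \<omega>"
    then obtain C where "g analytic_on UHP" "\<And>z. z \<in> UHP \<Longrightarrow> cmod (g z) \<le> C * \<omega> (Im z)"
      by (auto simp: H_infty_weighted_def)
    then show "g \<in> multipliers \<Phi>1 \<alpha> \<Phi>2 \<beta>"
      using \<omega>' by (intro multiplier_sufficient[OF 1 assms(2,3), of g C]) auto
  qed
qed

text \<open>Extended by zero to the closed lower half-plane, \<open>g\<close> becomes entire.\<close>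

lemma holomorphic_UHP_zero_boundary:
  assumes g: "g holomorphic_on UHP"
    and bound: "\<And>z. z \<in> UHP \<Longrightarrow> cmod (g z) \<le> \<eta> (Im z)"
    and lim: "(\<eta> \<longlongrightarrow> 0) (at_right 0)"
    and z: "z \<in> UHP"
  shows "g z = 0"
proof -
  define G where "G = (\<lambda>z. if Im z > 0 then g z else 0)"
  have up: "G holomorphic_on UHP"
    by (rule holomorphic_transform[OF g]) (auto simp: G_def UHP_def)
  have low: "G holomorphic_on {z. Im z < 0}"
    by (rule holomorphic_transform[of "\<lambda>_. 0"]) (auto simp: G_def)
  have "isCont G p" for p
  proof -
    consider "Im p > 0" | "Im p < 0" | "Im p = 0" by linarith
    then show ?thesis
    proof cases
      case 1
      then show ?thesis
        using holomorphic_on_imp_continuous_on[OF up] open_UHP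
        by (auto simp: continuous_on_eq_continuous_at UHP_def)
    next
      case 2
      then show ?thesis
        using holomorphic_on_imp_continuous_on[OF low] open_halfspace_Im_lt[of 0]
        by (auto simp: continuous_on_eq_continuous_at)
    next
      case 3
      have "G \<midarrow>p\<rightarrow> 0"
      proof (rule LIM_I)
        fix e :: real assume e: "e > 0"
        have "eventually (\<lambda>t. \<bar>\<eta> t\<bar> < e) (at_right 0)"
          using tendstoD[OF lim e] by (simp add: dist_real_def)
        then obtain d where d: "d > 0" "\<And>t. 0 < t \<Longrightarrow> t < d \<Longrightarrow> \<bar>\<eta> t\<bar> < e"
          unfolding eventually_at_right_field by auto
        have "cmod (G w - 0) < e" if w: "cmod (w - p) < d" for w
        proof (cases "Im w > 0")
          case True
          have "Im w \<le> cmod (w - p)" using 3 abs_Im_le_cmod[of "w - p"] by simp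
          with w d(2)[of "Im w"] bound[of w] True show ?thesis by (simp add: G_def UHP_def)
        qed (use e in \<open>simp add: G_def\<close>)
        with d(1) show "\<exists>s>0. \<forall>w. w \<noteq> p \<and> cmod (w - p) < s \<longrightarrow> cmod (G w - 0) < e" by blast
      qed
      then show ?thesis using 3 by (simp add: isCont_def G_def)
    qed
  qed
  then have "continuous_on UNIV G" by (simp add: continuous_at_imp_continuous_on)
  \<comment> \<open>The inner product with \<open>\<i>\<close> is the imaginary part, so the line of
    pasting is the real axis. Continuity there and holomorphy on both sides suffice; the identity
    theorem then spreads the zeros from the lower half-plane.\<close>
  then have entire: "G holomorphic_on UNIV"
    using up low by (intro holomorphic_on_paste_across_line[of UNIV \<i> G 0]) (auto simp: UHP_def)
  have "G z = 0"
    by (rule analytic_continuation_open[of "{z. Im z < 0}" UNIV G "\<lambda>_. 0"])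
      (use entire in \<open>auto simp: G_def open_halfspace_Im_lt intro: exI[of _ "-\<i>"]\<close>)
  then show ?thesis using z by (simp add: G_def UHP_def)
qed

section \<open>The three cases, read off from the weighted space\<close>

theorem theorem2p6:
  fixes \<Phi>1 \<Phi>2 :: "real \<Rightarrow> real" and \<alpha> \<beta> :: real and \<omega> :: "real \<Rightarrow> real"
  assumes "\<Phi>1 \<in> U_class" and "\<Phi>2 \<in> U_tilde"
    and "mono_on {0<..} (\<lambda>t. \<Phi>2 t / \<Phi>1 t)"
    and "\<alpha> > -1" and "\<beta> > -1"
    and \<omega>_def: "\<And>t. t > 0 \<Longrightarrow>
       \<omega> t = ginv \<Phi>2 (1 / t powr (2 + \<beta>)) / ginv \<Phi>1 (1 / t powr (2 + \<alpha>))"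
  shows
    "(nabla2 \<Phi>1 \<and> (\<exists>c C. 0 < c \<and> c \<le> C \<and> (\<forall>t>0. c \<le> \<omega> t \<and> \<omega> t \<le> C)) \<longrightarrow>
        (\<forall>g. g \<in> multipliers \<Phi>1 \<alpha> \<Phi>2 \<beta> \<longleftrightarrow> g \<in> H_infty))
   \<and> (mono_on {0<..} \<omega> \<and> (\<omega> \<longlongrightarrow> 0) (at_right 0) \<longrightarrow>
        (\<forall>g. g \<in> multipliers \<Phi>1 \<alpha> \<Phi>2 \<beta> \<longleftrightarrow> (\<forall>z\<in>UHP. g z = 0)))
   \<and> (nabla2 \<Phi>1 \<and> nabla2 (\<Phi>2 \<circ> ginv \<Phi>1) \<and>
       (\<forall>s t. 0 < s \<and> s \<le> t \<longrightarrow> \<omega> t \<le> \<omega> s) \<longrightarrow>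
        (\<forall>g. g \<in> multipliers \<Phi>1 \<alpha> \<Phi>2 \<beta> \<longleftrightarrow> g \<in> H_infty_weighted \<omega>))"
proof -
  have eq: "multipliers \<Phi>1 \<alpha> \<Phi>2 \<beta> = H_infty_weighted \<omega>"
    by (rule multipliers_eq_H_infty_weighted[OF assms(1-4) \<omega>_def])
  \<comment> \<open>Two-sided bounds on \<open>\<omega>\<close> exchange the two growth conditions
    at the cost of a constant. Absolute values enter because the constant \<open>A\<close> may be
    negative.\<close>
  have i: "H_infty_weighted \<omega> = H_infty"
    if c: "0 < c" and \<omega>: "\<And>t. t > 0 \<Longrightarrow> c \<le> \<omega> t \<and> \<omega> t \<le> C" for c C
  proof -
    have \<omega>z: "c \<le> \<omega> (Im z)" "\<omega> (Im z) \<le> C" if "z \<in> UHP" for z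
      using \<omega>[of "Im z"] that by (auto simp: UHP_def)
    have "\<exists>B. \<forall>z\<in>UHP. cmod (g z) \<le> B" if "\<forall>z\<in>UHP. cmod (g z) \<le> A * \<omega> (Im z)" for g A
    proof (intro exI[of _ "\<bar>A\<bar> * C"] ballI)
      fix z assume z: "z \<in> UHP"
      have "A * \<omega> (Im z) \<le> \<bar>A\<bar> * C"
        using \<omega>z[OF z] c by (intro mult_mono) auto
      with that z show "cmod (g z) \<le> \<bar>A\<bar> * C" by force
    qed
    moreover have "\<exists>B. \<forall>z\<in>UHP. cmod (g z) \<le> B * \<omega> (Im z)" if "\<forall>z\<in>UHP. cmod (g z) \<le> A" for g A
    proof (intro exI[of _ "\<bar>A\<bar> / c"] ballI)
      fix z assume z: "z \<in> UHP"
      have "\<bar>A\<bar> / c * c \<le> \<bar>A\<bar> / c * \<omega> (Im z)"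
        using \<omega>z[OF z] c by (intro mult_left_mono) auto
      with that z c show "cmod (g z) \<le> \<bar>A\<bar> / c * \<omega> (Im z)" by force
    qed
    ultimately show ?thesis
      unfolding H_infty_weighted_def H_infty_def by blast
  qed
  \<comment> \<open>The zero multiplier is any function vanishing on \<open>UHP\<close>, its values
    elsewhere being arbitrary. Forwards, \<open>C * \<omega>\<close> is the majorant that tends to 0
    at the real line.\<close>
  have ii: "g \<in> H_infty_weighted \<omega> \<longleftrightarrow> (\<forall>z\<in>UHP. g z = 0)"
    if lim: "(\<omega> \<longlongrightarrow> 0) (at_right 0)" for g
  proof
    assume "g \<in> H_infty_weighted \<omega>"
    then obtain C where g: "g analytic_on UHP" and C: "\<And>z. z \<in> UHP \<Longrightarrow> cmod (g z) \<le> C * \<omega> (Im z)"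
      by (auto simp: H_infty_weighted_def)
    have "((\<lambda>t. C * \<omega> t) \<longlongrightarrow> 0) (at_right 0)"
      using tendsto_mult_left[OF lim, of C] by simp
    then show "\<forall>z\<in>UHP. g z = 0"
      using holomorphic_UHP_zero_boundary[OF analytic_imp_holomorphic[OF g] C] by blast
  next
    assume 0: "\<forall>z\<in>UHP. g z = 0"
    have "g holomorphic_on UHP"
      by (rule holomorphic_transform[of "\<lambda>_. 0"]) (use 0 in auto)
    then have "g analytic_on UHP" using open_UHP by (simp add: analytic_on_open)
    then show "g \<in> H_infty_weighted \<omega>"
      using 0 by (auto simp: H_infty_weighted_def intro: exI[of _ 0])
  qed
  show ?thesis
    using i ii unfolding eq by blast
qed

end
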